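(* There exist universal constants $c,c'>0$ such that, for every $L,\mathcal G_0,D_{\mathcal Y}>0$ and every $\epsilon$ satisfying $$0<\epsilon\le c\min\{\sqrt{L\mathcal G_0},\,LD_{\mathcal Y}\},$$ there is an instance $f\in\mathcal F_{\rm NCC}^{\rm pd}(L,\mathcal G_0,D_{\mathcal Y})$ on which every deterministic zero-respecting first-order algorithm requires at least $c'L^2D_{\mathcal Y}\mathcal G_0\,\epsilon^{-3}$ (that is, $\Omega(L^2D_{\mathcal Y}\mathcal G_0\,\epsilon^{-3})$) joint oracle evaluations to return an $\epsilon$-stationary point of the primal value function.
   Context: All norms are Euclidean. For a vector $v$, $\operatorname{supp}(v)$ is the set of indices of its nonzero coordinates. For a nonempty closed convex set $C$, $\iota_C$ is its indicator function ($0$ on $C$, $+\infty$ off $C$) and $\mathsf P_C$ is Euclidean projection onto $C$. Function class. Given $L,\mathcal G_0,D_{\mathcal Y}>0$, $\mathcal F_{\rm NCC}^{\rm pd}(L,\mathcal G_0,D_{\mathcal Y})$ is the class of continuously differentiable functions $f:\mathcal X\times\mathcal Y\to\mathbb R$, over all finite dimensions $d_x,d_y$, where $\mathcal X\subset\mathbb R^{d_x}$, $\mathcal Y\subset\mathbb R^{d_y}$ are nonempty closed convex sets with $0\in\mathcal X$, $0\in\mathcal Y$, such that: (1) $\|\nabla f(x,y)-\nabla f(x',y')\|\le L\|(x,y)-(x',y')\|$ for all $(x,y),(x',y')\in\mathcal X\times\mathcal Y$ (joint gradient); (2) $f(x,\cdot)$ is concave on $\mathcal Y$ for every $x\in\mathcal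 X$; (3) $\operatorname{diam}(\mathcal Y):=\sup_{y,y'\in\mathcal Y}\|y-y'\|\le D_{\mathcal Y}$; (4) $\max_{y\in\mathcal Y}f(0,y)-\inf_{x\in\mathcal X}f(x,0)\le\mathcal G_0$. Stationarity. Let $\Phi_f(x):=\max_{y\in\mathcal Y}f(x,y)$ and $\varphi_f:=\Phi_f+\iota_{\mathcal X}$ on $\mathbb R^{d_x}$. The Moreau envelope is $(\varphi_f)_\lambda(x):=\min_{p\in\mathbb R^{d_x}}\{\varphi_f(p)+\frac1{2\lambda}\|p-x\|^2\}$. Since $\varphi_f$ is $L$-weakly convex, for $0<\lambda<1/L$ the minimizer $p_\lambda(x)$ is unique, the envelope is continuously differentiable, and $\nabla(\varphi_f)_\lambda(x)=\lambda^{-1}(x-p_\lambda(x))$. A point $x\in\mathcal X$ is $\epsilon$-stationary for the primal value function if $\|\nabla(\varphi_f)_{1/(2L)}(x)\|\le\epsilon$. Oracle and algorithms. The (joint) deterministic first-order oracle returns $(f(x,y),\nabla_xf(x,y),\nabla_yf(x,y))$ at a query $(x,y)\in\mathcal X\times\mathcal Y$. A deterministic zero-respecting first-order algorithm starts at $(x^0,y^0)=(0,0)$, queries the oracle at $(x^0,y^0),(x^1,y^1),\dots$, and chooses each new iterate from the previous oracle responses so that $x^{t+1}=\mathsf P_{\mathcal X}(u)$ for some $u$ with $\operatorname{supp}(u)\subseteq\bigcup_{0\le i\le t}(\operatorname{supp}(x^i)\cup\operatorname{supp}(\nabla_xf(x^i,y^i)))$ and $y^{t+1}=\mathsf P_{\mathcal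 Y}(v)$ for some $v$ with $\operatorname{supp}(v)\subseteq\bigcup_{0\le i\le t}(\operatorname{supp}(y^i)\cup\operatorname{supp}(\nabla_yf(x^i,y^i)))$. The primal output after $q$ oracle calls (at $(x^0,y^0),\dots,(x^{q-1},y^{q-1})$) is required to satisfy the same zero-respecting condition as a primal iterate: it equals $\mathsf P_{\mathcal X}(u)$ with $\operatorname{supp}(u)\subseteq\bigcup_{0\le i\le q-1}(\operatorname{supp}(x^i)\cup\operatorname{supp}(\nabla_xf(x^i,y^i)))$. "Universal constant" means a numerical constant independent of all problem parameters and dimensions. *)

theory Defs
  imports "HOL-Analysis.Analysis"
begin

text \<open>
  The dimensions of the hard instance depend on the accuracy, so they cannot be types.  All
  vectors live in one pre-Hilbert space, the finitely supported real sequences with the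
  \<open>\<ell>\<^sub>2\<close> inner product, and \<open>\<real>\<^sup>d\<close> is its subspace of vectors supported in \<open>{..<d}\<close>.  Restricted to
  such a subspace, the ambient norm and topology are the usual Euclidean ones.  Pairs carry the
  library's product inner product, i.e. the joint Euclidean norm.
\<close>

typedef fvec = "{v :: nat \<Rightarrow> real. finite {i. v i \<noteq> 0}}"
  morphisms coord Abs_fvec
  by (rule exI[of _ "\<lambda>_. 0"]) simp

setup_lifting type_definition_fvec

definition supp :: "fvec \<Rightarrow> nat set" where
  "supp v = {i. coord v i \<noteq> 0}"

lemma finite_supp [simp]: "finite (supp v)"
  using coord[of v] by (simp add: supp_def)

lemma fvec_eqI: "(\<And>i. coord v i = coord w i) \<Longrightarrow> v = w"
  by (simp add: coord_inject[symmetric] fun_eq_iff)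

instantiation fvec :: real_vector
begin

lift_definition zero_fvec :: fvec is "\<lambda>_. 0" by simp

lift_definition plus_fvec :: "fvec \<Rightarrow> fvec \<Rightarrow> fvec" is "\<lambda>v w i. v i + w i"
  by (erule (1) finite_subset[OF _ finite_UnI, rotated]) auto

lift_definition minus_fvec :: "fvec \<Rightarrow> fvec \<Rightarrow> fvec" is "\<lambda>v w i. v i - w i"
  by (erule (1) finite_subset[OF _ finite_UnI, rotated]) auto

lift_definition uminus_fvec :: "fvec \<Rightarrow> fvec" is "\<lambda>v i. - v i" by simp

lift_definition scaleR_fvec :: "real \<Rightarrow> fvec \<Rightarrow> fvec" is "\<lambda>r v i. r * v i"
  by (rule rev_finite_subset) auto

instance
  by standard (transfer; simp add: fun_eq_iff algebra_simps)+

end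

lemmas coord_simps [simp] =
  zero_fvec.rep_eq plus_fvec.rep_eq minus_fvec.rep_eq uminus_fvec.rep_eq scaleR_fvec.rep_eq

lemma supp_zero [simp]: "supp 0 = {}"
  by (simp add: supp_def)

instantiation fvec :: real_inner
begin

definition inner_fvec :: "fvec \<Rightarrow> fvec \<Rightarrow> real" where
  "inner_fvec v w = (\<Sum>i\<in>supp v \<inter> supp w. coord v i * coord w i)"

definition norm_fvec :: "fvec \<Rightarrow> real" where
  "norm_fvec v = sqrt (inner v v)"

definition sgn_fvec :: "fvec \<Rightarrow> fvec" where
  "sgn_fvec v = v /\<^sub>R norm v"

definition dist_fvec :: "fvec \<Rightarrow> fvec \<Rightarrow> real" where
  "dist_fvec v w = norm (v - w)"

definition uniformity_fvec :: "(fvec \<times> fvec) filter" where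
  "uniformity_fvec = (INF e\<in>{0<..}. principal {(v, w). dist v w < e})"

definition open_fvec :: "fvec set \<Rightarrow> bool" where
  "open_fvec U \<longleftrightarrow> (\<forall>v\<in>U. eventually (\<lambda>(v', w). v' = v \<longrightarrow> w \<in> U) uniformity)"

lemma inner_fvec_superset:
  assumes "finite S" "supp v \<inter> supp w \<subseteq> S"
  shows "inner v w = (\<Sum>i\<in>S. coord v i * coord w i)"
  unfolding inner_fvec_def
  by (rule sum.mono_neutral_left) (use assms in \<open>auto simp: supp_def\<close>)

instance
proof
  fix u v w :: fvec and r :: real
  show "inner v w = inner w v"
    by (simp add: inner_fvec_def Int_commute mult.commute)
  let ?S = "supp u \<union> supp v \<union> supp w"
  have eq: "inner a b = (\<Sum>i\<in>?S. coord a i * coord b i)"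
    if "supp a \<inter> supp b \<subseteq> ?S" for a b
    using that by (intro inner_fvec_superset) auto
  have "inner (u + v) w = (\<Sum>i\<in>?S. coord (u + v) i * coord w i)"
    by (rule eq) (auto simp: supp_def)
  moreover have "inner u w = (\<Sum>i\<in>?S. coord u i * coord w i)"
    and "inner v w = (\<Sum>i\<in>?S. coord v i * coord w i)"
    by (rule eq; auto)+
  ultimately show "inner (u + v) w = inner u w + inner v w"
    by (simp add: distrib_right sum.distrib)
  have "inner (r *\<^sub>R v) w = (\<Sum>i\<in>?S. coord (r *\<^sub>R v) i * coord w i)"
    by (rule eq) (auto simp: supp_def)
  moreover have "inner v w = (\<Sum>i\<in>?S. coord v i * coord w i)"
    by (rule eq) auto
  ultimately show "inner (r *\<^sub>R v) w = r * inner v w"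
    by (simp add: sum_distrib_left mult.assoc)
  show "0 \<le> inner v v"
    by (simp add: inner_fvec_def sum_nonneg)
  show "inner v v = 0 \<longleftrightarrow> v = 0"
  proof
    assume "inner v v = 0"
    then have "\<forall>i\<in>supp v. coord v i * coord v i = 0"
      by (subst sum_nonneg_eq_0_iff[symmetric]) (auto simp: inner_fvec_def)
    then show "v = 0"
      by (intro fvec_eqI) (auto simp: supp_def)
  qed (simp add: inner_fvec_def)
qed (simp_all add: norm_fvec_def sgn_fvec_def dist_fvec_def uniformity_fvec_def open_fvec_def)

end

definition Rd :: "nat \<Rightarrow> fvec set" where
  "Rd d = {v. supp v \<subseteq> {..<d}}"

lemma subspace_Rd: "subspace (Rd d)"
  by (force simp: subspace_def Rd_def supp_def)

text \<open>
  Gradient at \<open>z\<close> of a function on the Euclidean space \<open>V\<close> (a linear subspace of the ambient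
  type).  Differentiability is relative to all of \<open>V\<close>, so \<open>f\<close> has to be differentiable
  at boundary points of its domain in the two-sided sense, as the restriction of a
  function on a neighbourhood.  This makes the gradient unique even if the domain has empty
  interior in \<open>V\<close>.
\<close>

definition has_gradient :: "'a::real_inner set \<Rightarrow> ('a \<Rightarrow> real) \<Rightarrow> 'a \<Rightarrow> 'a \<Rightarrow> bool" where
  "has_gradient V f z g \<longleftrightarrow> g \<in> V \<and> (f has_derivative (\<lambda>h. inner h g)) (at z within V)"

definition gradient :: "'a::real_inner set \<Rightarrow> ('a \<Rightarrow> real) \<Rightarrow> 'a \<Rightarrow> 'a" where
  "gradient V f z = (THE g. has_gradient V f z g)"

lemma has_gradient_unique:
  assumes V: "subspace V" and z: "z \<in> V"
    and g: "has_gradient V f z g" and g': "has_gradient V f z g'"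
  shows "g = g'"
proof (rule ccontr)
  assume ne: "g \<noteq> g'"
  define w where "w = g - g'"
  have w: "w \<in> V" "w \<noteq> 0"
    using V g g' ne by (auto simp: w_def has_gradient_def subspace_diff)
  have "((\<lambda>y. f y - f y) has_derivative (\<lambda>h. inner h g - inner h g')) (at z within V)"
    using g g' unfolding has_gradient_def by (intro has_derivative_diff) auto
  then have d: "((\<lambda>_. 0 :: real) has_derivative (\<lambda>h. inner h w)) (at z within V)"
    by (simp add: w_def inner_diff_right)
  have line: "((\<lambda>t :: real. z + t *\<^sub>R w) has_derivative (\<lambda>t. t *\<^sub>R w)) (at 0)"
    by (auto intro!: derivative_eq_intros)
  have sub: "range (\<lambda>t :: real. z + t *\<^sub>R w) \<subseteq> V"
    using V z w by (auto intro: subspace_add subspace_scale)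
  have "((\<lambda>_. 0 :: real) has_derivative (\<lambda>h. inner h w))
      (at (z + (0::real) *\<^sub>R w) within range (\<lambda>t :: real. z + t *\<^sub>R w))"
    using has_derivative_subset[OF d sub] by simp
  from diff_chain_within[OF line this]
  have "((\<lambda>_ :: real. 0 :: real) has_derivative (\<lambda>t. inner (t *\<^sub>R w) w)) (at 0)"
    by (simp add: o_def)
  then have "(\<lambda>t :: real. inner (t *\<^sub>R w) w) = (\<lambda>_. 0)"
    by (rule has_derivative_unique) simp
  from fun_cong[OF this, of 1] show False
    using w by simp
qed

lemma gradient_eq:
  "subspace V \<Longrightarrow> z \<in> V \<Longrightarrow> has_gradient V f z g \<Longrightarrow> gradient V f z = g"
  unfolding gradient_def by (blast intro: has_gradient_unique)

text \<open>
  Same body as the library's \<open>closest_point\<close>, which is restricted to the class \<open>heine_borel\<close>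
  (\<open>fvec\<close> is not of that class).
\<close>

definition proj :: "fvec set \<Rightarrow> fvec \<Rightarrow> fvec" where
  "proj C u = (SOME p. p \<in> C \<and> (\<forall>q\<in>C. dist u p \<le> dist u q))"

record problem =
  dim_x :: nat
  dim_y :: nat
  dom_x :: "fvec set"
  dom_y :: "fvec set"
  obj :: "fvec \<times> fvec \<Rightarrow> real"

definition grad :: "problem \<Rightarrow> fvec \<times> fvec \<Rightarrow> fvec \<times> fvec" where
  "grad P = gradient (Rd (dim_x P) \<times> Rd (dim_y P)) (obj P)"

definition grad_x :: "problem \<Rightarrow> fvec \<times> fvec \<Rightarrow> fvec" where
  "grad_x P z = fst (grad P z)"

definition grad_y :: "problem \<Rightarrow> fvec \<times> fvec \<Rightarrow> fvec" where
  "grad_y P z = snd (grad P z)"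

text \<open>
  The gap is taken in \<open>ereal\<close>, so that an objective unbounded below in \<open>x\<close> has gap \<open>\<infinity>\<close>.
  Boundedness of \<open>dom_y\<close> is explicit because \<open>diameter\<close> is meaningless for unbounded sets.
\<close>

definition F_NCC :: "real \<Rightarrow> real \<Rightarrow> real \<Rightarrow> problem set" where
  "F_NCC L G0 D = {P.
     dom_x P \<subseteq> Rd (dim_x P) \<and> closed (dom_x P) \<and> convex (dom_x P) \<and> 0 \<in> dom_x P \<and>
     dom_y P \<subseteq> Rd (dim_y P) \<and> closed (dom_y P) \<and> convex (dom_y P) \<and> 0 \<in> dom_y P \<and>
     (\<forall>z\<in>dom_x P \<times> dom_y P.
        \<exists>g. has_gradient (Rd (dim_x P) \<times> Rd (dim_y P)) (obj P) z g) \<and>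
     continuous_on (dom_x P \<times> dom_y P) (grad P) \<and>
     (\<forall>z\<in>dom_x P \<times> dom_y P. \<forall>z'\<in>dom_x P \<times> dom_y P.
        norm (grad P z - grad P z') \<le> L * norm (z - z')) \<and>
     (\<forall>x\<in>dom_x P. concave_on (dom_y P) (\<lambda>y. obj P (x, y))) \<and>
     bounded (dom_y P) \<and> diameter (dom_y P) \<le> D \<and>
     (SUP y\<in>dom_y P. ereal (obj P (0, y))) - (INF x\<in>dom_x P. ereal (obj P (x, 0))) \<le> ereal G0}"

definition primal_value :: "problem \<Rightarrow> fvec \<Rightarrow> ereal" where
  "primal_value P x = (SUP y\<in>dom_y P. ereal (obj P (x, y)))"

definition ext_primal :: "problem \<Rightarrow> fvec \<Rightarrow> ereal" where
  "ext_primal P x = (if x \<in> dom_x P then primal_value P x else \<infinity>)"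

definition moreau :: "nat \<Rightarrow> real \<Rightarrow> (fvec \<Rightarrow> ereal) \<Rightarrow> fvec \<Rightarrow> ereal" where
  "moreau d lam \<phi> x = (INF p\<in>Rd d. \<phi> p + ereal ((norm (p - x))\<^sup>2 / (2 * lam)))"

text \<open>
  On \<open>F_NCC L G0 D\<close> the envelope with parameter \<open>1/(2L)\<close> is finite and continuously
  differentiable on \<open>\<real>\<^sup>d\<close>, so passing to real values loses nothing and the gradient exists.
\<close>

definition stationary :: "real \<Rightarrow> problem \<Rightarrow> real \<Rightarrow> fvec \<Rightarrow> bool" where
  "stationary L P \<epsilon> x \<longleftrightarrow> x \<in> dom_x P \<and>
     (\<exists>g. has_gradient (Rd (dim_x P))
            (\<lambda>x'. real_of_ereal (moreau (dim_x P) (1 / (2 * L)) (ext_primal P) x')) x g \<and>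
          norm g \<le> \<epsilon>)"

type_synonym response = "real \<times> fvec \<times> fvec"

definition fo_response :: "problem \<Rightarrow> fvec \<times> fvec \<Rightarrow> response" where
  "fo_response P z = (obj P z, grad_x P z, grad_y P z)"

text \<open>
  A deterministic algorithm maps the list of responses received so far to its next query, and to
  the primal point it outputs if it stops at that moment.  Dependence on the known data (domains,
  parameters, accuracy) needs no argument, since algorithms are quantified after the instance.
\<close>

record algorithm =
  next_query :: "response list \<Rightarrow> fvec \<times> fvec"
  primal_output :: "response list \<Rightarrow> fvec"

primrec responses :: "problem \<Rightarrow> algorithm \<Rightarrow> nat \<Rightarrow> response list" where
  "responses P A 0 = []"
| "responses P A (Suc t) =
     responses P A t @ [fo_response P (next_query A (responses P A t))]"

definition iterate :: "problem \<Rightarrow> algorithm \<Rightarrow> nat \<Rightarrow> fvec \<times> fvec" where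
  "iterate P A t = next_query A (responses P A t)"

definition output_after :: "problem \<Rightarrow> algorithm \<Rightarrow> nat \<Rightarrow> fvec" where
  "output_after P A q = primal_output A (responses P A q)"

text \<open>Coordinates discovered by the first \<open>q\<close> queries, i.e. those at iterates \<open>0, \<dots>, q - 1\<close>.\<close>

definition seen_x :: "problem \<Rightarrow> algorithm \<Rightarrow> nat \<Rightarrow> nat set" where
  "seen_x P A q = (\<Union>i<q. supp (fst (iterate P A i)) \<union> supp (grad_x P (iterate P A i)))"

definition seen_y :: "problem \<Rightarrow> algorithm \<Rightarrow> nat \<Rightarrow> nat set" where
  "seen_y P A q = (\<Union>i<q. supp (snd (iterate P A i)) \<union> supp (grad_y P (iterate P A i)))"

definition zero_respecting :: "problem \<Rightarrow> algorithm \<Rightarrow> bool" where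
  "zero_respecting P A \<longleftrightarrow>
     iterate P A 0 = (0, 0) \<and>
     (\<forall>t. \<exists>u v. supp u \<subseteq> seen_x P A (Suc t) \<and> supp v \<subseteq> seen_y P A (Suc t) \<and>
        iterate P A (Suc t) = (proj (dom_x P) u, proj (dom_y P) v)) \<and>
     (\<forall>q. \<exists>u. supp u \<subseteq> seen_x P A q \<and> output_after P A q = proj (dom_x P) u)"

end

theory Submission
  imports Defs
begin

text \<open>
  The hard instance is \<open>f (x, y) = g x + L/4 \<cdot> \<langle>y, A x\<rangle>\<close> on the nonnegative orthant times a ball of
  diameter \<open>D\<close>, so that its primal value is \<open>g x + L D/8 \<cdot> \<parallel>A x\<parallel>\<close>.  The coordinates form \<open>T\<close> blocks
  of length \<open>m\<close>; the kernel of \<open>A\<close> makes (weighted) entries agree within a block, while \<open>g\<close> links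
  the end of each block to the start of the next, \<open>T\<close> being of order \<open>L G\<^sub>0 / \<epsilon>\<^sup>2\<close> and \<open>m\<close> of order
  \<open>L D / \<epsilon>\<close>.  A zero-respecting method discovers one coordinate per query, hence has a zero last
  coordinate for \<open>T m\<close> queries.

  Since \<open>g\<close> is decreasing in every coordinate, it never pulls the two ends of a block apart, and so
  disagreement inside blocks is never stationary, no matter how many blocks disagree at once:
  raising the lower ends does not increase \<open>g\<close>, and \<open>\<parallel>A x\<parallel>\<close> decreases at a rate of at least
  \<open>1 / (2 m)\<close>.  If on the other hand the ends agree, the first unfinished block can be raised as a
  whole, along the kernel of \<open>A\<close>.
\<close>

section \<open>Coordinates and norms of finitely supported vectors\<close>

lemma inner_Rd:
  assumes "v \<in> Rd N"
  shows "inner v w = (\<Sum>i<N. coord v i * coord w i)"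
  by (rule inner_fvec_superset) (use assms in \<open>auto simp: Rd_def\<close>)

lemma norm_sq_Rd:
  assumes "v \<in> Rd N"
  shows "(norm v)\<^sup>2 = (\<Sum>i<N. (coord v i)\<^sup>2)"
  using inner_Rd[OF assms, of v] by (simp add: power2_norm_eq_inner) (simp add: power2_eq_square)

lemma norm_sq_supp: "(norm v)\<^sup>2 = (\<Sum>i\<in>supp v. (coord v i)\<^sup>2)"
  using inner_fvec_superset[of "supp v" v v] by (simp add: power2_norm_eq_inner) (simp add: power2_eq_square)

lemma abs_coord_le_norm: "\<bar>coord v i\<bar> \<le> norm v"
proof (cases "i \<in> supp v")
  case True
  then have "(coord v i)\<^sup>2 \<le> (\<Sum>i\<in>supp v. (coord v i)\<^sup>2)"
    by (intro member_le_sum) auto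
  then show ?thesis
    by (metis norm_sq_supp abs_le_square_iff abs_norm_cancel)
qed (simp add: supp_def)

lemma bounded_linear_coord: "bounded_linear (\<lambda>v. coord v i)"
  by (rule bounded_linear_intro[of _ 1]) (auto simp: abs_coord_le_norm)

lemmas has_derivative_coord [derivative_intros] =
  bounded_linear.has_derivative[OF bounded_linear_coord]

lemmas continuous_on_coord [continuous_intros] =
  bounded_linear.continuous_on[OF bounded_linear_coord]

lemma mem_Rd_iff: "v \<in> Rd N \<longleftrightarrow> (\<forall>i\<ge>N. coord v i = 0)"
  by (simp add: Rd_def supp_def subset_iff) (metis not_less)

lemma closed_Rd: "closed (Rd N)"
proof -
  have "Rd N = (\<Inter>i\<in>{N..}. {v. coord v i = 0})"
    by (auto simp: mem_Rd_iff)
  also have "closed \<dots>"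
    by (intro closed_INT ballI closed_Collect_eq continuous_intros)
  finally show ?thesis .
qed

lift_definition mkvec :: "nat \<Rightarrow> (nat \<Rightarrow> real) \<Rightarrow> fvec" is "\<lambda>N F i. if i < N then F i else 0"
  by simp

declare mkvec.rep_eq [simp]

lemma mkvec_in_Rd [simp]: "mkvec N F \<in> Rd N"
  by (simp add: mem_Rd_iff)

section \<open>Projections that create no new coordinates\<close>

text \<open>The \<open>mkvec\<close> term is the \<open>i\<close>-th unit vector, so this is
  stability under zeroing a coordinate. Both the orthant and the ball have it.\<close>

definition coord_solid :: "fvec set \<Rightarrow> bool" where
  "coord_solid C \<longleftrightarrow> (\<forall>p\<in>C. \<forall>i. p - coord p i *\<^sub>R mkvec (Suc i) (\<lambda>j. of_bool (j = i)) \<in> C)"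

text \<open>If a nearest point were nonzero where \<open>u\<close> vanishes, zeroing that coordinate
  would stay in \<open>C\<close> and come strictly closer to \<open>u\<close>. Existence of a
  nearest point is assumed because \<open>proj\<close> is a choice.\<close>

lemma supp_proj_subset:
  assumes solid: "coord_solid C"
    and ex: "\<exists>p\<in>C. \<forall>q\<in>C. dist u p \<le> dist u q"
  shows "proj C u \<in> C \<and> supp (proj C u) \<subseteq> supp u"
proof -
  define p where "p = proj C u"
  have p: "p \<in> C \<and> (\<forall>q\<in>C. dist u p \<le> dist u q)"
    unfolding p_def proj_def by (rule someI_ex) (use ex in blast)
  have "i \<in> supp u" if i: "i \<in> supp p" for i
  proof (rule ccontr)
    assume "i \<notin> supp u"
    then have ui: "coord u i = 0" by (simp add: supp_def)
    define e where "e = mkvec (Suc i) (\<lambda>j. of_bool (j = i))"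
    define q where "q = p - coord p i *\<^sub>R e"
    have "q \<in> C"
      using solid p by (auto simp: coord_solid_def q_def e_def)
    then have "(norm (u - p))\<^sup>2 \<le> (norm (u - q))\<^sup>2"
      using p by (auto simp: dist_norm)
    moreover have ip: "inner e w = coord w i" for w
      by (subst inner_Rd[of _ "Suc i"]) (auto simp: e_def)
    have "(norm (u - q))\<^sup>2 = (norm (u - p))\<^sup>2 - (coord p i)\<^sup>2"
    proof -
      have "u - q = (u - p) + coord p i *\<^sub>R e" by (simp add: q_def)
      then have "(norm (u - q))\<^sup>2 = (norm (u - p))\<^sup>2 + 2 * coord p i * inner e (u - p) + (coord p i)\<^sup>2 * inner e e"
        by (simp only: power2_norm_eq_inner)
          (simp add: inner_add_left inner_add_right inner_commute algebra_simps power2_eq_square)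
      also have "\<dots> = (norm (u - p))\<^sup>2 - (coord p i)\<^sup>2"
        unfolding ip by (simp add: ui e_def power2_eq_square)
      finally show ?thesis .
    qed
    moreover have "(coord p i)\<^sup>2 > 0" using i by (simp add: supp_def)
    ultimately show False by linarith
  qed
  then show ?thesis using p by (auto simp: p_def)
qed

definition orthant :: "nat \<Rightarrow> fvec set" where
  "orthant N = {v \<in> Rd N. \<forall>i. 0 \<le> coord v i}"

lemma orthant_closed: "closed (orthant N)"
proof -
  have "orthant N = Rd N \<inter> (\<Inter>i. {v. 0 \<le> coord v i})"
    by (auto simp: orthant_def)
  also have "closed \<dots>"
    by (intro closed_Int closed_Rd closed_INT ballI closed_Collect_le continuous_intros)
  finally show ?thesis .
qed

lemma orthant_convex: "convex (orthant N)"
  by (auto simp: convex_def orthant_def mem_Rd_iff)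

lemma proj_orthant:
  assumes "u \<in> Rd N"
  shows "proj (orthant N) u \<in> orthant N \<and> supp (proj (orthant N) u) \<subseteq> supp u"
proof (rule supp_proj_subset)
  show "coord_solid (orthant N)"
    by (auto simp: coord_solid_def orthant_def mem_Rd_iff)
  show "\<exists>p\<in>orthant N. \<forall>q\<in>orthant N. dist u p \<le> dist u q"
  proof (intro bexI ballI)
    \<comment> \<open>The positive part is nearest in each coordinate separately.\<close>
    let ?p = "mkvec N (\<lambda>i. max 0 (coord u i))"
    show "?p \<in> orthant N" by (simp add: orthant_def)
    fix q assume q: "q \<in> orthant N"
    have R: "u - ?p \<in> Rd N" "u - q \<in> Rd N"
      using assms q subspace_Rd[of N] by (auto simp: orthant_def intro!: subspace_diff)
    have "(norm (u - ?p))\<^sup>2 \<le> (norm (u - q))\<^sup>2"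
      unfolding norm_sq_Rd[OF R(1)] norm_sq_Rd[OF R(2)]
    proof (rule sum_mono)
      fix i assume "i \<in> {..<N}"
      moreover have "0 \<le> coord q i" using q by (simp add: orthant_def)
      ultimately show "(coord (u - ?p) i)\<^sup>2 \<le> (coord (u - q) i)\<^sup>2"
        by (auto simp: max_def abs_le_square_iff[symmetric])
    qed
    then show "dist u ?p \<le> dist u q"
      by (simp add: dist_norm)
  qed
qed

definition Rd_ball :: "nat \<Rightarrow> real \<Rightarrow> fvec set" where
  "Rd_ball N R = {v \<in> Rd N. norm v \<le> R}"

lemma Rd_ball_eq: "Rd_ball N R = Rd N \<inter> cball 0 R"
  by (auto simp: Rd_ball_def)

lemma proj_Rd_ball:
  assumes "u \<in> Rd N" "0 < R"
  shows "proj (Rd_ball N R) u \<in> Rd_ball N R \<and> supp (proj (Rd_ball N R) u) \<subseteq> supp u"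
proof (rule supp_proj_subset)
  show "coord_solid (Rd_ball N R)"
    unfolding coord_solid_def
  proof (intro ballI allI)
    fix p i assume p: "p \<in> Rd_ball N R"
    let ?q = "p - coord p i *\<^sub>R mkvec (Suc i) (\<lambda>j. of_bool (j = i))"
    have c: "coord ?q j = (if j = i then 0 else coord p j)" for j by auto
    have q: "?q \<in> Rd N" using p by (auto simp: Rd_ball_def mem_Rd_iff)
    have "(norm ?q)\<^sup>2 \<le> (norm p)\<^sup>2"
      using p unfolding norm_sq_Rd[OF q]
      by (subst norm_sq_Rd[of _ N]) (auto simp: Rd_ball_def intro!: sum_mono)
    then have "norm ?q \<le> norm p" by simp
    then show "?q \<in> Rd_ball N R" using p q by (simp add: Rd_ball_def)
  qed
  show "\<exists>p\<in>Rd_ball N R. \<forall>q\<in>Rd_ball N R. dist u p \<le> dist u q"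
  proof (cases "norm u \<le> R")
    case True
    then show ?thesis using assms by (intro bexI[of _ u]) (auto simp: Rd_ball_def)
  next
    case False
    \<comment> \<open>Radial rescaling; its distance \<open>norm u - R\<close> is optimal by the
      reverse triangle inequality.\<close>
    let ?p = "(R / norm u) *\<^sub>R u"
    have "?p \<in> Rd_ball N R"
      using assms False subspace_Rd by (auto simp: Rd_ball_def intro: subspace_scale)
    moreover have "dist u ?p \<le> dist u q" if "q \<in> Rd_ball N R" for q
    proof -
      have "u - ?p = (1 - R / norm u) *\<^sub>R u" by (simp add: algebra_simps)
      then have "norm (u - ?p) = \<bar>1 - R / norm u\<bar> * norm u"
        by (simp only: norm_scaleR)
      also have "\<dots> = norm u - R"
      proof -
        have "R / norm u < 1" using False assms by (simp add: divide_less_eq)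
        then have "\<bar>1 - R / norm u\<bar> = 1 - R / norm u" by simp
        moreover have "u \<noteq> 0" using False assms by auto
        ultimately show ?thesis by (simp add: left_diff_distrib)
      qed
      also have "\<dots> \<le> norm u - norm q" using that by (simp add: Rd_ball_def)
      also have "\<dots> \<le> norm (u - q)" by (rule norm_triangle_ineq2)
      finally show ?thesis by (simp add: dist_norm)
    qed
    ultimately show ?thesis by blast
  qed
qed

section \<open>A lower bound on the gradient of a Moreau envelope\<close>

text \<open>The infimum defining the envelope need not be attained: near-minimisers \<open>p\<close> suffice, first
  to see that they lie within \<open>\<epsilon> / L\<close> of \<open>x\<close>, then to transfer the descent from \<open>\<Phi>\<close> to \<open>M\<close>.\<close>

lemma envelope_gradient_large:
  fixes M \<Phi> :: "'a::real_inner \<Rightarrow> real"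
  assumes V: "subspace V" "X \<subseteq> V" "x \<in> V"
    and pos: "0 < L" "0 < \<epsilon>" "0 < \<tau>\<^sub>0"
    and grad: "has_gradient V M x g"
    and upper: "\<And>p x'. p \<in> X \<Longrightarrow> x' \<in> V \<Longrightarrow> M x' \<le> \<Phi> p + L * (norm (p - x'))\<^sup>2"
    and approx: "\<And>\<delta>. 0 < \<delta> \<Longrightarrow> \<exists>p\<in>X. \<Phi> p + L * (norm (p - x))\<^sup>2 \<le> M x + \<delta>"
    and descent: "\<And>p \<tau>. p \<in> X \<Longrightarrow> norm (p - x) \<le> \<epsilon> / L \<Longrightarrow> 0 < \<tau> \<Longrightarrow> \<tau> \<le> \<tau>\<^sub>0 \<Longrightarrow>
      \<exists>h. norm h \<le> \<tau> \<and> p + h \<in> X \<and> \<Phi> (p + h) \<le> \<Phi> p - 2 * \<epsilon> * \<tau>"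
  shows "\<epsilon> < norm g"
proof (rule ccontr)
  assume "\<not> \<epsilon> < norm g"
  then have g: "norm g \<le> \<epsilon>" by simp
  have "(M has_derivative (\<lambda>h. inner h g)) (at x within V)"
    using grad by (simp add: has_gradient_def)
  then obtain d where d: "d > 0"
    and dM: "\<And>y. y \<in> V \<Longrightarrow> norm (y - x) < d \<Longrightarrow>
      norm (M y - M x - inner (y - x) g) \<le> \<epsilon> / 4 * norm (y - x)"
    using pos unfolding has_derivative_within_alt by (metis zero_less_divide_iff zero_less_numeral)
  \<comment> \<open>The gradient accounts for rate \<open>\<epsilon>\<close>, the differentiability
    remainder for \<open>\<epsilon> / 4\<close>.\<close>
  have lower: "M x - 5 / 4 * \<epsilon> * norm h \<le> M (x + h)" if "h \<in> V" "norm h < d" for h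
  proof -
    have "norm (M (x + h) - M x - inner h g) \<le> \<epsilon> / 4 * norm h"
      using dM[of "x + h"] that V by (auto intro: subspace_add)
    moreover have "\<bar>inner h g\<bar> \<le> norm h * \<epsilon>"
      using Cauchy_Schwarz_ineq2[of h g] mult_left_mono[OF g, of "norm h"] by simp
    moreover have "5 / 4 * \<epsilon> * norm h = \<epsilon> / 4 * norm h + norm h * \<epsilon>" by simp
    ultimately show ?thesis unfolding real_norm_def by linarith
  qed
  \<comment> \<open>The three bounds allow \<open>descent\<close>, keep steps inside the radius
    \<open>d\<close> of \<open>dM\<close>, and give
    \<open>L * \<tau> \<le> \<epsilon> / 4\<close>.\<close>
  define \<tau> where "\<tau> = Min {\<tau>\<^sub>0, d / 2, \<epsilon> / (4 * L)}"
  have \<tau>: "0 < \<tau>" "\<tau> \<le> \<tau>\<^sub>0" "\<tau> < d" "\<tau> \<le> \<epsilon> / (4 * L)"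
    using pos d by (auto simp: \<tau>_def min_less_iff_disj)
  then have L\<tau>: "L * \<tau> \<le> \<epsilon> / 4" using pos by (simp add: field_simps)
  have "0 < \<epsilon> * \<tau> / 4" using pos \<tau> by simp
  from approx[OF this] obtain p where p: "p \<in> X"
    and pM: "\<Phi> p + L * (norm (p - x))\<^sup>2 \<le> M x + \<epsilon> * \<tau> / 4" by blast
  \<comment> \<open>Moving \<open>x\<close> by \<open>\<tau>\<close> towards \<open>p\<close>
    shrinks the penalty from \<open>L * n^2\<close> to \<open>L * (n - \<tau>)^2\<close>; as
    \<open>M\<close> falls at rate at most \<open>5 / 4 * \<epsilon>\<close>, \<open>n\<close>
    cannot be large.\<close>
  have near: "norm (p - x) \<le> \<epsilon> / L"
  proof (cases "p = x")
    case False
    define n where "n = norm (p - x)"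
    have n: "n > 0" using False by (simp add: n_def)
    define h where "h = (\<tau> / n) *\<^sub>R (p - x)"
    have h: "h \<in> V" "norm h = \<tau>"
      using V p n \<tau> by (auto simp: h_def n_def intro!: subspace_scale subspace_diff)
    have "p - (x + h) = (1 - \<tau> / n) *\<^sub>R (p - x)" by (simp add: h_def algebra_simps)
    then have "(norm (p - (x + h)))\<^sup>2 = ((1 - \<tau> / n) * n)\<^sup>2"
      by (simp add: power_mult_distrib n_def)
    also have "(1 - \<tau> / n) * n = n - \<tau>" using n by (simp add: field_simps)
    finally have "M (x + h) \<le> \<Phi> p + L * (n - \<tau>)\<^sup>2"
      using upper[OF p, of "x + h"] V h by (auto intro: subspace_add)
    with lower[of h] h \<tau> pM have "0 \<le> 5 / 4 * \<epsilon> * \<tau> + \<epsilon> * \<tau> / 4 + L * ((n - \<tau>)\<^sup>2 - n\<^sup>2)"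
      by (simp add: n_def algebra_simps)
    also have "\<dots> = \<tau> * (3 / 2 * \<epsilon> + L * \<tau> - 2 * (L * n))"
      by (simp add: power2_eq_square algebra_simps)
    finally have "0 \<le> 3 / 2 * \<epsilon> + L * \<tau> - 2 * (L * n)"
      using \<tau>(1) by (simp add: zero_le_mult_iff)
    then have "L * n \<le> \<epsilon>" using L\<tau> pos by linarith
    then show ?thesis using pos by (simp add: n_def field_simps)
  qed (use pos in simp)
  obtain h where h: "norm h \<le> \<tau>" "p + h \<in> X" "\<Phi> (p + h) \<le> \<Phi> p - 2 * \<epsilon> * \<tau>"
    using descent[OF p near \<tau>(1,2)] by blast
  have hV: "h \<in> V"
    using subspace_diff[OF V(1), of "p + h" p] h(2) p V(2) by auto
  \<comment> \<open>Translating \<open>p\<close> and \<open>x\<close> by the same \<open>h\<close>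
    leaves the quadratic term unchanged. The rates \<open>2 - 1/4 - 5/4 > 0\<close> then contradict
    \<open>lower\<close>.\<close>
  have "M (x + h) \<le> \<Phi> (p + h) + L * (norm (p + h - (x + h)))\<^sup>2"
    using V hV by (intro upper h) (auto intro: subspace_add)
  also have "\<dots> \<le> M x + \<epsilon> * \<tau> / 4 - 2 * \<epsilon> * \<tau>"
    using h(3) pM by simp
  finally have "M (x + h) \<le> M x + \<epsilon> * \<tau> / 4 - 2 * \<epsilon> * \<tau>" .
  moreover have "M x - 5 / 4 * \<epsilon> * norm h \<le> M (x + h)"
    using h \<tau> hV by (intro lower) auto
  moreover have "\<epsilon> * norm h \<le> \<epsilon> * \<tau>" using h pos by simp
  ultimately have "\<epsilon> * \<tau> \<le> 0" by (simp add: algebra_simps)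
  then show False using pos \<tau> by (simp add: mult_le_0_iff)
qed

section \<open>Finite sums over coordinates\<close>

lemma sum_sq_le_norm_sq: "(\<Sum>i<N. (coord v i)\<^sup>2) \<le> (norm v)\<^sup>2"
proof -
  have "(\<Sum>i<N. (coord v i)\<^sup>2) = (\<Sum>i\<in>{..<N} \<inter> supp v. (coord v i)\<^sup>2)"
    by (rule sum.mono_neutral_right) (auto simp: supp_def)
  also have "\<dots> \<le> (\<Sum>i\<in>supp v. (coord v i)\<^sup>2)"
    by (rule sum_mono2) auto
  finally show ?thesis by (simp add: norm_sq_supp)
qed

text \<open>The hypothesis excludes the last index, so reindexing by \<open>Suc\<close> loses no
  term. It carries the summations by parts for \<open>A\<close> and for the derivative of
  \<open>g\<close>.\<close>

lemma sum_if_shift: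
  assumes "\<And>i. Q i \<Longrightarrow> Suc i < N"
  shows "(\<Sum>i<N. if Q i then F (Suc i) else 0) =
    (\<Sum>i<N. if 0 < i \<and> Q (i - 1) then F i else (0 :: real))"
proof (cases N)
  case (Suc n)
  have "(\<Sum>i<N. if Q i then F (Suc i) else 0) = (\<Sum>i<n. if Q i then F (Suc i) else 0)"
    using assms[of n] Suc by auto
  also have "\<dots> = (\<Sum>i<N. if 0 < i \<and> Q (i - 1) then F i else 0)"
    unfolding Suc sum.lessThan_Suc_shift by simp
  finally show ?thesis .
qed simp

section \<open>A saturating scalar function and its derivative\<close>

definition sat :: "real \<Rightarrow> real \<Rightarrow> real" where
  "sat l s = s / (l + s)"

text \<open>The derivative \<open>l / (l + s)^2\<close>, written through
  \<open>1 - sat l s = l / (l + s)\<close> so that its bounds follow from those of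
  \<open>sat\<close>.\<close>

definition dsat :: "real \<Rightarrow> real \<Rightarrow> real" where
  "dsat l s = (1 - sat l s)\<^sup>2 / l"

lemma sat_0 [simp]: "sat l 0 = 0"
  by (simp add: sat_def)

context
  fixes l :: real
  assumes l: "0 < l"
begin

lemma sat_bounds: "0 \<le> s \<Longrightarrow> 0 \<le> sat l s" "0 \<le> s \<Longrightarrow> sat l s \<le> 1"
  using l by (auto simp: sat_def)

lemma sat_diff:
  "0 \<le> a \<Longrightarrow> 0 \<le> b \<Longrightarrow> sat l b - sat l a = l * (b - a) / ((l + a) * (l + b))"
  using l by (simp add: sat_def field_simps)

lemma sat_mono: "0 \<le> a \<Longrightarrow> a \<le> b \<Longrightarrow> sat l a \<le> sat l b"
proof -
  assume "0 \<le> a" "a \<le> b"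
  moreover from this have "0 \<le> l * (b - a) / ((l + a) * (l + b))"
    using l by simp
  ultimately show ?thesis using sat_diff[of a b] by simp
qed

lemma sat_lipschitz:
  assumes "0 \<le> a" "0 \<le> b"
  shows "\<bar>sat l b - sat l a\<bar> \<le> \<bar>b - a\<bar> / l"
proof -
  have "l * l \<le> (l + a) * (l + b)"
    using assms l by (intro mult_mono) auto
  then have "l * \<bar>b - a\<bar> / ((l + a) * (l + b)) \<le> l * \<bar>b - a\<bar> / (l * l)"
    using assms l by (intro divide_left_mono) auto
  then show ?thesis
    using assms l by (simp add: sat_diff abs_mult)
qed

lemma dsat_bounds: "0 \<le> s \<Longrightarrow> 0 \<le> dsat l s" "0 \<le> s \<Longrightarrow> dsat l s \<le> 1 / l"
  using l sat_bounds[of s] by (auto simp: dsat_def power_le_one intro!: divide_right_mono)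

lemma dsat_lipschitz:
  assumes "0 \<le> a" "0 \<le> b"
  shows "\<bar>dsat l b - dsat l a\<bar> \<le> 2 * \<bar>b - a\<bar> / l\<^sup>2"
proof -
  \<comment> \<open>Difference of two squares; the second factor is at most 2 in absolute
    value.\<close>
  have "dsat l b - dsat l a = (sat l b - sat l a) * (sat l a + sat l b - 2) / l"
    by (simp add: dsat_def power2_eq_square algebra_simps diff_divide_distrib[symmetric])
  then have "\<bar>dsat l b - dsat l a\<bar> = \<bar>sat l b - sat l a\<bar> * \<bar>sat l a + sat l b - 2\<bar> / l"
    using l by (simp add: abs_mult)
  also have "\<dots> \<le> (\<bar>b - a\<bar> / l) * 2 / l"
    using assms l sat_lipschitz[OF assms] sat_bounds[of a] sat_bounds[of b]
    by (intro divide_right_mono mult_mono) auto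
  finally show ?thesis by (simp add: power2_eq_square mult_ac)
qed

text \<open>Two-sided also at \<open>s = 0\<close>, where \<open>l + s\<close> stays positive
  nearby. Gradients on the boundary of the orthant rely on this.\<close>

lemma has_derivative_sat:
  assumes "0 \<le> s"
  shows "(sat l has_real_derivative dsat l s) (at s)"
proof -
  have "((\<lambda>s. s / (l + s)) has_real_derivative dsat l s) (at s)"
  proof -
    have "1 - sat l s = l / (l + s)" using assms l by (simp add: sat_def field_simps)
    then have "dsat l s = l / ((l + s) * (l + s))"
      using l by (simp add: dsat_def power2_eq_square)
    then show ?thesis
      using assms l by (auto intro!: derivative_eq_intros)
  qed
  then show ?thesis by (simp add: sat_def[abs_def])
qed

end

section \<open>The hard instance\<close>

text \<open>\<open>2 \<le> m\<close> keeps the two ends of a block distinct. \<open>m_le\<close> is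
  calibrated so that a penalty of weight \<open>L * D / 8\<close>, decreasing at rate
  \<open>1 / (2 * m)\<close>, falls at rate at least \<open>2 * \<epsilon>\<close>.\<close>

locale chain_instance =
  fixes L \<epsilon> D :: real and m T :: nat
  assumes L: "0 < L" and eps: "0 < \<epsilon>" and D: "0 < D"
    and m: "2 \<le> m" and T: "1 \<le> T"
    and m_le: "32 * \<epsilon> * real m \<le> L * D"
begin

definition N :: nat where "N = T * m"

text \<open>Length scale at which an entry counts as raised. With
  \<open>lam / ell^2 = L / 8\<close>, which bounds the smoothness of \<open>g\<close>, the factor
  768 gives \<open>lam = 96 * \<epsilon> * ell\<close>, as needed for descent at rate
  \<open>2 * \<epsilon>\<close>.\<close>

definition ell :: real where "ell = 768 * \<epsilon> / L"

definition lam :: real where "lam = L * ell\<^sup>2 / 8"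

definition link :: "nat \<Rightarrow> bool" where "link i \<longleftrightarrow> \<not> m dvd Suc i"

text \<open>Consensus vectors have entries proportional to \<open>1 / rho i\<close>: the two ends of a block are heavy,
  so that moving a whole block costs no more than a constant times moving one end.\<close>

definition rho :: "nat \<Rightarrow> real" where
  "rho i = (if m dvd i \<or> m dvd Suc i then 1 / sqrt (real m) else 1)"

definition A :: "fvec \<Rightarrow> fvec" where
  "A x = mkvec N (\<lambda>i. if link i then rho i * coord x i - rho (Suc i) * coord x (Suc i) else 0)"

definition At :: "fvec \<Rightarrow> fvec" where
  "At y = mkvec N (\<lambda>i. (if link i then rho i * coord y i else 0) -
     (if 0 < i \<and> link (i - 1) then rho i * coord y (i - 1) else 0))"

text \<open>Enters \<open>g\<close> only at block starts, where \<open>i - 1\<close> is the end of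
  the previous block. The value 1 at index 0 starts the chain.\<close>

definition gate :: "fvec \<Rightarrow> nat \<Rightarrow> real" where
  "gate x i = (if i = 0 then 1 else sat ell (coord x (i - 1)))"

definition g :: "fvec \<Rightarrow> real" where
  "g x = - lam * (\<Sum>i<N. if m dvd i then gate x i * sat ell (coord x i) else 0)"

text \<open>Up to \<open>- lam\<close>, the factor of \<open>dsat ell (coord x i)\<close> in the
  \<open>i\<close>-th partial derivative of \<open>g\<close>: a block start is multiplied by its
  gate, a block end is itself the gate of the next start.\<close>

definition coef :: "fvec \<Rightarrow> nat \<Rightarrow> real" where
  "coef x i = (if m dvd i then gate x i else 0) +
     (if m dvd Suc i \<and> Suc i < N then sat ell (coord x (Suc i)) else 0)"

definition dg :: "fvec \<Rightarrow> fvec" where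
  "dg x = mkvec N (\<lambda>i. - lam * (coef x i * dsat ell (coord x i)))"

definition P :: problem where
  "P = \<lparr>dim_x = N, dim_y = N, dom_x = orthant N, dom_y = Rd_ball N (D / 2),
    obj = (\<lambda>z. g (fst z) + L / 4 * inner (snd z) (A (fst z)))\<rparr>"

lemma P_simps [simp]:
  "dim_x P = N" "dim_y P = N" "dom_x P = orthant N" "dom_y P = Rd_ball N (D / 2)"
  "obj P = (\<lambda>z. g (fst z) + L / 4 * inner (snd z) (A (fst z)))"
  by (simp_all add: P_def)

lemma m_pos: "0 < m" and N_pos: "0 < N" and ell: "0 < ell" and lam: "0 < lam"
  using L eps m T by (auto simp: N_def ell_def lam_def)

lemma lam_div_ell: "lam / ell\<^sup>2 = L / 8" "lam = 96 * \<epsilon> * ell"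
  using ell L eps by (auto simp: lam_def ell_def power2_eq_square)

lemma link_Suc_less: "i < N \<Longrightarrow> link i \<Longrightarrow> Suc i < N"
  by (metis N_def Suc_lessI dvd_triv_right link_def)

lemma link_div: "link i \<Longrightarrow> Suc i div m = i div m"
  by (simp add: link_def div_Suc dvd_eq_mod_eq_0)

lemma dvd_exclusive: "m dvd i \<Longrightarrow> \<not> m dvd Suc i"
  using m dvd_diff_nat[of m "Suc i" i] by auto

lemma rho_bounds: "0 < rho i" "rho i \<le> 1"
  using m by (auto simp: rho_def)

section \<open>The operator \<open>A\<close> and its adjoint\<close>

text \<open>Each coordinate occurs in at most two rows with weight at most 1, and
  \<open>(a - b)^2 \<le> 2 * a^2 + 2 * b^2\<close>.\<close>

lemma A_norm: "norm (A x) \<le> 2 * norm x"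
proof -
  have "(norm (A x))\<^sup>2 = (\<Sum>i<N. (coord (A x) i)\<^sup>2)"
    by (rule norm_sq_Rd) (simp add: A_def)
  also have "\<dots> \<le> (\<Sum>i<N. 2 * (coord x i)\<^sup>2 + (if link i \<and> Suc i < N then 2 * (coord x (Suc i))\<^sup>2 else 0))"
  proof (rule sum_mono)
    fix i assume "i \<in> {..<N}"
    have sq: "(rho j * coord x j)\<^sup>2 \<le> (coord x j)\<^sup>2" for j
      using rho_bounds[of j] by (simp add: power_mult_distrib mult_left_le_one_le power_le_one)
    have "(a - b)\<^sup>2 \<le> 2 * a\<^sup>2 + 2 * b\<^sup>2" for a b :: real
      using zero_le_power2[of "a + b"] by (simp add: power2_eq_square algebra_simps)
    from this[of "rho i * coord x i" "rho (Suc i) * coord x (Suc i)"]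
    show "(coord (A x) i)\<^sup>2 \<le> 2 * (coord x i)\<^sup>2 + (if link i \<and> Suc i < N then 2 * (coord x (Suc i))\<^sup>2 else 0)"
      using sq[of i] sq[of "Suc i"] link_Suc_less[of i] \<open>i \<in> {..<N}\<close> by (auto simp: A_def)
  qed
  also have "\<dots> = (\<Sum>i<N. 2 * (coord x i)\<^sup>2) +
      (\<Sum>i<N. if 0 < i \<and> (link (i - 1) \<and> Suc (i - 1) < N) then 2 * (coord x i)\<^sup>2 else 0)"
    unfolding sum.distrib
    by (subst sum_if_shift[where Q = "\<lambda>i. link i \<and> Suc i < N"]) simp_all
  also have "\<dots> \<le> (\<Sum>i<N. 2 * (coord x i)\<^sup>2) + (\<Sum>i<N. 2 * (coord x i)\<^sup>2)"
    by (intro add_left_mono sum_mono) auto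
  also have "\<dots> = 4 * (\<Sum>i<N. (coord x i)\<^sup>2)"
    by (simp add: sum_distrib_left)
  also have "\<dots> \<le> (2 * norm x)\<^sup>2"
    using sum_sq_le_norm_sq[where v = x and N = N] by (simp add: power_mult_distrib)
  finally show ?thesis by (rule power2_le_imp_le) simp
qed

lemma A_bounded_linear: "bounded_linear A"
proof (rule bounded_linear_intro)
  show "A (x + y) = A x + A y" for x y
    by (rule fvec_eqI) (auto simp: A_def algebra_simps)
  show "A (r *\<^sub>R x) = r *\<^sub>R A x" for r x
    by (rule fvec_eqI) (auto simp: A_def algebra_simps)
  show "norm (A x) \<le> norm x * 2" for x using A_norm[of x] by simp
qed

lemma At_diff: "At (x - y) = At x - At y"
  by (rule fvec_eqI) (auto simp: At_def algebra_simps)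

lemma adjoint: "inner y (A x) = inner x (At y)"
proof -
  have "inner y (A x) = (\<Sum>i<N. coord (A x) i * coord y i)"
    by (subst inner_commute, rule inner_Rd) (simp add: A_def)
  \<comment> \<open>\<open>coord y (Suc i - 1)\<close> presents the second summand as a function of
    \<open>Suc i\<close>, the shape \<open>sum_if_shift\<close> expects.\<close>
  also have "\<dots> = (\<Sum>i<N. if link i then rho i * coord x i * coord y i else 0) -
      (\<Sum>i<N. if link i \<and> Suc i < N then rho (Suc i) * coord x (Suc i) * coord y (Suc i - 1) else 0)"
    unfolding sum_subtractf[symmetric]
    by (rule sum.cong) (auto simp: A_def algebra_simps dest: link_Suc_less)
  also have "(\<Sum>i<N. if link i \<and> Suc i < N then rho (Suc i) * coord x (Suc i) * coord y (Suc i - 1) else 0)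
      = (\<Sum>i<N. if 0 < i \<and> (link (i - 1) \<and> Suc (i - 1) < N) then rho i * coord x i * coord y (i - 1) else 0)"
    by (rule sum_if_shift[where Q = "\<lambda>i. link i \<and> Suc i < N"]) simp
  also have "(\<Sum>i<N. if link i then rho i * coord x i * coord y i else 0) - \<dots> = (\<Sum>i<N. coord (At y) i * coord x i)"
    unfolding sum_subtractf[symmetric]
    by (rule sum.cong) (auto simp: At_def algebra_simps)
  also have "\<dots> = inner x (At y)"
    by (subst inner_commute, rule inner_Rd[symmetric]) (simp add: At_def)
  finally show ?thesis .
qed

text \<open>The bound passes to the adjoint by pairing \<open>y\<close> with \<open>A (At y)\<close>
  and cancelling one factor.\<close>

lemma At_norm: "norm (At y) \<le> 2 * norm y"
proof -
  have "(norm (At y))\<^sup>2 = inner y (A (At y))"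
    by (simp add: power2_norm_eq_inner adjoint)
  also have "\<dots> \<le> norm y * norm (A (At y))" by (rule norm_cauchy_schwarz)
  also have "\<dots> \<le> norm y * (2 * norm (At y))"
    by (intro mult_left_mono A_norm) simp
  finally show ?thesis
    by (cases "At y = 0") (auto simp: power2_eq_square)
qed

section \<open>Derivative and smoothness of \<open>g\<close>\<close>

lemma gate_bounds: "x \<in> orthant N \<Longrightarrow> 0 \<le> gate x i" "x \<in> orthant N \<Longrightarrow> gate x i \<le> 1"
  using sat_bounds[OF ell] by (auto simp: gate_def orthant_def)

lemma coef_bounds:
  assumes "x \<in> orthant N"
  shows "0 \<le> coef x i" "coef x i \<le> 1"
  using gate_bounds[OF assms, of i] sat_bounds[OF ell, of "coord x (Suc i)"] assms dvd_exclusive[of i]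
  by (auto simp: coef_def orthant_def)

text \<open>By the product rule, differentiating a gate hits the coordinate just before a block
  start; shifting that sum by one yields the second part of \<open>coef\<close>.\<close>

lemma g_has_derivative:
  assumes x: "x \<in> orthant N"
  shows "(g has_derivative (\<lambda>h. inner h (dg x))) (at x within S)"
proof -
  have nn: "0 \<le> coord x i" for i using x by (simp add: orthant_def)
  have ds: "((\<lambda>x. sat ell (coord x i)) has_derivative (\<lambda>h. dsat ell (coord x i) * coord h i)) (at x within S)" for i
    using has_derivative_compose[OF has_derivative_coord[OF has_derivative_ident]
      has_derivative_sat[OF ell nn, of i, unfolded has_field_derivative_def]] .
  have dgate: "((\<lambda>x. gate x i) has_derivative
      (\<lambda>h. if i = 0 then 0 else dsat ell (coord x (i - 1)) * coord h (i - 1))) (at x within S)" for i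
    unfolding gate_def by (cases "i = 0") (simp_all add: ds)
  have "((\<lambda>x. if m dvd i then gate x i * sat ell (coord x i) else 0) has_derivative
      (\<lambda>h. if m dvd i then gate x i * (dsat ell (coord x i) * coord h i) +
         (if i = 0 then 0 else dsat ell (coord x (i - 1)) * coord h (i - 1)) * sat ell (coord x i) else 0))
      (at x within S)" for i
    by (cases "m dvd i") (auto intro!: has_derivative_mult dgate ds)
  then have "(g has_derivative
     (\<lambda>h. - lam * (\<Sum>i<N. if m dvd i then gate x i * (dsat ell (coord x i) * coord h i) +
         (if i = 0 then 0 else dsat ell (coord x (i - 1)) * coord h (i - 1)) * sat ell (coord x i) else 0)))
      (at x within S)"
    unfolding g_def[abs_def] by (intro has_derivative_mult_right has_derivative_sum)
  moreover have "- lam * (\<Sum>i<N. if m dvd i then gate x i * (dsat ell (coord x i) * coord h i) +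
         (if i = 0 then 0 else dsat ell (coord x (i - 1)) * coord h (i - 1)) * sat ell (coord x i) else 0)
     = inner h (dg x)" (is "- lam * ?S = _") for h
  proof -
    let ?F = "\<lambda>i. dsat ell (coord x (i - 1)) * coord h (i - 1) * sat ell (coord x i)"
    have "?S = (\<Sum>i<N. if m dvd i then gate x i * dsat ell (coord x i) * coord h i else 0) +
        (\<Sum>i<N. if 0 < i \<and> (m dvd Suc (i - 1) \<and> Suc (i - 1) < N) then ?F i else 0)"
      unfolding sum.distrib[symmetric] by (rule sum.cong) auto
    also have "(\<Sum>i<N. if 0 < i \<and> (m dvd Suc (i - 1) \<and> Suc (i - 1) < N) then ?F i else 0) =
        (\<Sum>i<N. if m dvd Suc i \<and> Suc i < N then ?F (Suc i) else 0)"
      by (rule sum_if_shift[where Q = "\<lambda>i. m dvd Suc i \<and> Suc i < N", symmetric]) simp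
    also have "(\<Sum>i<N. if m dvd i then gate x i * dsat ell (coord x i) * coord h i else 0) + \<dots> =
        (\<Sum>i<N. coef x i * dsat ell (coord x i) * coord h i)"
      unfolding sum.distrib[symmetric] by (rule sum.cong) (auto simp: coef_def algebra_simps)
    finally have "- lam * ?S = (\<Sum>i<N. coord (dg x) i * coord h i)"
      by (simp add: dg_def sum_distrib_left mult_ac)
    then show ?thesis
      by (subst inner_commute, subst inner_Rd[of _ N]) (simp_all add: dg_def)
  qed
  ultimately show ?thesis by simp
qed

text \<open>Component \<open>i\<close> changes by at most \<open>L / 8\<close> times
  \<open>2 * E i\<close> plus the changes at its two neighbours. Cauchy-Schwarz with weights 2, 1, 1
  and summation over shifts give \<open>(L / 8)^2 * 16 = (L / 2)^2\<close>.\<close>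

lemma dg_lipschitz:
  assumes x: "x \<in> orthant N" and x': "x' \<in> orthant N"
  shows "norm (dg x - dg x') \<le> L / 2 * norm (x - x')"
proof -
  define E where "E i = \<bar>coord x i - coord x' i\<bar>" for i
  define b where "b i = (if 0 < i then E (i - 1) else 0)" for i
  define c where "c i = (if Suc i < N then E (Suc i) else 0)" for i
  have nn: "0 \<le> coord x i" "0 \<le> coord x' i" for i using x x' by (auto simp: orthant_def)
  have bc: "0 \<le> b i" "0 \<le> c i" "0 \<le> E i" for i by (auto simp: b_def c_def E_def)
  have R: "x - x' \<in> Rd N"
    using x x' subspace_Rd by (auto simp: orthant_def intro: subspace_diff)
  have coef_diff: "\<bar>coef x i - coef x' i\<bar> \<le> (b i + c i) / ell" if "i < N" for i
  proof -
    have "\<bar>gate x i - gate x' i\<bar> \<le> b i / ell"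
      using sat_lipschitz[OF ell nn(2,1), of "i - 1" "i - 1"] by (simp add: gate_def b_def E_def)
    moreover have "\<bar>sat ell (coord x (Suc i)) - sat ell (coord x' (Suc i))\<bar> \<le> c i / ell" if "Suc i < N"
      using sat_lipschitz[OF ell nn(2,1), of "Suc i" "Suc i"] that by (simp add: c_def E_def)
    moreover have "0 \<le> b i / ell" "0 \<le> c i / ell"
      using bc ell by simp_all
    ultimately show ?thesis
      using dvd_exclusive[of i] by (auto simp: coef_def add_divide_distrib)
  qed
  have comp: "\<bar>coord (dg x - dg x') i\<bar> \<le> L / 8 * (2 * E i + b i + c i)" if "i < N" for i
  proof -
    have "coord (dg x - dg x') i = - lam * ((coef x i - coef x' i) * dsat ell (coord x i) +
        coef x' i * (dsat ell (coord x i) - dsat ell (coord x' i)))"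
      using that by (simp add: dg_def algebra_simps)
    then have "\<bar>coord (dg x - dg x') i\<bar> = lam * \<bar>(coef x i - coef x' i) * dsat ell (coord x i) +
        coef x' i * (dsat ell (coord x i) - dsat ell (coord x' i))\<bar>"
      using lam by (simp add: abs_mult)
    also have "\<dots> \<le> lam * ((b i + c i) / ell * (1 / ell) + 1 * (2 * E i / ell\<^sup>2))"
    proof (intro mult_left_mono order_trans[OF abs_triangle_ineq] add_mono)
      show "\<bar>(coef x i - coef x' i) * dsat ell (coord x i)\<bar> \<le> (b i + c i) / ell * (1 / ell)"
        unfolding abs_mult
        using coef_diff[OF that] dsat_bounds[OF ell nn(1), of i] bc ell by (intro mult_mono) auto
      show "\<bar>coef x' i * (dsat ell (coord x i) - dsat ell (coord x' i))\<bar> \<le> 1 * (2 * E i / ell\<^sup>2)"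
        unfolding abs_mult E_def
        using coef_bounds[OF x', of i] dsat_lipschitz[OF ell nn(2,1), of i i] by (intro mult_mono) auto
    qed (use lam in simp)
    also have "\<dots> = lam / ell\<^sup>2 * (2 * E i + b i + c i)"
      using ell by (simp add: power2_eq_square field_simps)
    finally show ?thesis by (simp only: lam_div_ell(1))
  qed
  have "(norm (dg x - dg x'))\<^sup>2 = (\<Sum>i<N. (coord (dg x - dg x') i)\<^sup>2)"
    using subspace_Rd by (intro norm_sq_Rd subspace_diff) (auto simp: dg_def)
  also have "\<dots> \<le> (\<Sum>i<N. (L / 8)\<^sup>2 * (4 * (2 * (E i)\<^sup>2 + (b i)\<^sup>2 + (c i)\<^sup>2)))"
  proof (rule sum_mono)
    fix i assume "i \<in> {..<N}"
    then have "\<bar>coord (dg x - dg x') i\<bar>\<^sup>2 \<le> (L / 8 * (2 * E i + b i + c i))\<^sup>2"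
      by (intro power_mono comp) auto
    also have "\<dots> = (L / 8)\<^sup>2 * (2 * E i + b i + c i)\<^sup>2" by (rule power_mult_distrib)
    also have "(2 * E i + b i + c i)\<^sup>2 \<le> 4 * (2 * (E i)\<^sup>2 + (b i)\<^sup>2 + (c i)\<^sup>2)"
    proof -
      have "4 * (2 * (E i)\<^sup>2 + (b i)\<^sup>2 + (c i)\<^sup>2) - (2 * E i + b i + c i)\<^sup>2 =
          2 * (E i - b i)\<^sup>2 + 2 * (E i - c i)\<^sup>2 + (b i - c i)\<^sup>2"
        by (simp add: power2_eq_square algebra_simps)
      moreover have "\<dots> \<ge> 0" by simp
      ultimately show ?thesis by linarith
    qed
    finally show "(coord (dg x - dg x') i)\<^sup>2 \<le> (L / 8)\<^sup>2 * (4 * (2 * (E i)\<^sup>2 + (b i)\<^sup>2 + (c i)\<^sup>2))"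
      by (simp add: mult_left_mono)
  qed
  also have "\<dots> = (L / 4)\<^sup>2 * (2 * (\<Sum>i<N. (E i)\<^sup>2) + (\<Sum>i<N. (b i)\<^sup>2) + (\<Sum>i<N. (c i)\<^sup>2))"
    by (simp add: sum_distrib_left sum.distrib power2_eq_square algebra_simps)
  also have "\<dots> \<le> (L / 4)\<^sup>2 * (2 * (\<Sum>i<N. (E i)\<^sup>2) + (\<Sum>i<N. (E i)\<^sup>2) + (\<Sum>i<N. (E i)\<^sup>2))"
  proof (intro mult_left_mono add_mono order_refl)
    obtain n where n: "N = Suc n" using N_pos by (cases N) auto
    show "(\<Sum>i<N. (b i)\<^sup>2) \<le> (\<Sum>i<N. (E i)\<^sup>2)"
      unfolding n sum.lessThan_Suc_shift[of "\<lambda>i. (b i)\<^sup>2"] by (simp add: b_def)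
    show "(\<Sum>i<N. (c i)\<^sup>2) \<le> (\<Sum>i<N. (E i)\<^sup>2)"
      unfolding n sum.lessThan_Suc_shift[of "\<lambda>i. (E i)\<^sup>2"] by (simp add: c_def n)
  qed auto
  also have "\<dots> = (L / 2)\<^sup>2 * (\<Sum>i<N. (coord (x - x') i)\<^sup>2)"
    by (simp add: E_def power2_eq_square)
  also have "\<dots> = (L / 2 * norm (x - x'))\<^sup>2"
    by (simp only: norm_sq_Rd[OF R] power_mult_distrib)
  finally show ?thesis
    by (rule power2_le_imp_le) (use L in simp)
qed

section \<open>Membership in the function class\<close>

lemma grad_exists:
  assumes "z \<in> orthant N \<times> Rd N"
  shows "has_gradient (Rd N \<times> Rd N) (obj P) z
    (dg (fst z) + (L / 4) *\<^sub>R At (snd z), (L / 4) *\<^sub>R A (fst z))"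
  unfolding has_gradient_def
proof
  show "(dg (fst z) + (L / 4) *\<^sub>R At (snd z), (L / 4) *\<^sub>R A (fst z)) \<in> Rd N \<times> Rd N"
    using subspace_Rd[of N] by (auto simp: dg_def At_def A_def intro!: subspace_add subspace_scale)
  have x: "fst z \<in> orthant N" using assms by auto
  have "((\<lambda>z. g (fst z)) has_derivative (\<lambda>h. inner (fst h) (dg (fst z)))) (at z within Rd N \<times> Rd N)"
    by (rule has_derivative_compose[OF has_derivative_fst[OF has_derivative_ident] g_has_derivative[OF x, of UNIV]])
  moreover have "((\<lambda>z. L / 4 * inner (snd z) (A (fst z))) has_derivative
      (\<lambda>h. L / 4 * (inner (snd z) (A (fst h)) + inner (snd h) (A (fst z))))) (at z within Rd N \<times> Rd N)"
    by (rule has_derivative_mult_right[OF has_derivative_inner[OF has_derivative_snd[OF has_derivative_ident]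
      bounded_linear.has_derivative[OF A_bounded_linear has_derivative_fst[OF has_derivative_ident]]]])
  ultimately have "(obj P has_derivative (\<lambda>h. inner (fst h) (dg (fst z)) +
      L / 4 * (inner (snd z) (A (fst h)) + inner (snd h) (A (fst z))))) (at z within Rd N \<times> Rd N)"
    unfolding P_simps by (rule has_derivative_add)
  moreover have "inner (fst h) (dg (fst z)) +
      L / 4 * (inner (snd z) (A (fst h)) + inner (snd h) (A (fst z))) =
      inner h (dg (fst z) + (L / 4) *\<^sub>R At (snd z), (L / 4) *\<^sub>R A (fst z))" for h
    using adjoint[of "snd z" "fst h"]
    by (simp only: inner_prod_def fst_conv snd_conv inner_add_right inner_scaleR_right)
      (simp add: algebra_simps)
  ultimately show "(obj P has_derivative (\<lambda>h. inner h
      (dg (fst z) + (L / 4) *\<^sub>R At (snd z), (L / 4) *\<^sub>R A (fst z)))) (at z within Rd N \<times> Rd N)"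
    by (simp only:)
qed

lemma subspace_prod: "subspace (Rd N \<times> Rd N)"
  by (intro subspace_Times subspace_Rd)

lemma grad_eq:
  assumes "x \<in> orthant N" "y \<in> Rd N"
  shows "grad P (x, y) = (dg x + (L / 4) *\<^sub>R At y, (L / 4) *\<^sub>R A x)"
proof -
  have "(x, y) \<in> Rd N \<times> Rd N" "(x, y) \<in> orthant N \<times> Rd N"
    using assms by (auto simp: orthant_def)
  from gradient_eq[OF subspace_prod this(1) grad_exists[OF this(2)]]
  show ?thesis by (simp only: grad_def P_simps(1,2) fst_conv snd_conv)
qed

lemma card_starts: "card {i. i < N \<and> m dvd i} = T"
proof -
  have "{i. i < N \<and> m dvd i} = (\<lambda>k. k * m) ` {..<T}"
    using m_pos by (auto simp: N_def image_iff elim: dvdE)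
  moreover have "inj_on (\<lambda>k. k * m) {..<T}" using m_pos by (auto simp: inj_on_def)
  ultimately show ?thesis by (simp add: card_image)
qed

lemma g_lower:
  assumes x: "x \<in> orthant N"
  shows "- lam * real T \<le> g x"
proof -
  have "(\<Sum>i<N. if m dvd i then gate x i * sat ell (coord x i) else 0) \<le> (\<Sum>i<N. if m dvd i then 1 else 0)"
  proof (rule sum_mono)
    fix i
    show "(if m dvd i then gate x i * sat ell (coord x i) else 0) \<le> (if m dvd i then 1 else 0)"
      using gate_bounds[OF x, of i] sat_bounds[OF ell, of "coord x i"] x
      by (auto simp: orthant_def mult_le_one)
  qed
  also have "\<dots> = real T"
  proof -
    have "{..<N} \<inter> {i. m dvd i} = {i. i < N \<and> m dvd i}" by auto
    then show ?thesis by (simp add: sum.If_cases card_starts)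
  qed
  finally show ?thesis using lam by (simp add: g_def mult_left_mono)
qed

lemma g_0: "g 0 = 0"
  by (auto simp: g_def intro!: sum.neutral)

lemma A_0: "A 0 = 0"
  by (rule linear_0) (rule bounded_linear.linear[OF A_bounded_linear])

lemma zero_in: "0 \<in> orthant N" "0 \<in> Rd_ball N (D / 2)"
  using D by (auto simp: orthant_def Rd_ball_def mem_Rd_iff)

text \<open>The budget \<open>L\<close> splits evenly: \<open>L / 2\<close> for \<open>g\<close> and
  \<open>L / 4 * 2\<close> for the bilinear coupling.\<close>

lemma grad_lipschitz:
  assumes "z \<in> orthant N \<times> Rd N" "z' \<in> orthant N \<times> Rd N"
  shows "norm (grad P z - grad P z') \<le> L * norm (z - z')"
proof -
  obtain x y x' y' where z: "z = (x, y)" "z' = (x', y')" by (cases z, cases z')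
  have xy: "x \<in> orthant N" "y \<in> Rd N" "x' \<in> orthant N" "y' \<in> Rd N" using assms z by auto
  have "grad P z - grad P z' = (dg x - dg x', 0) + (L / 4) *\<^sub>R (At (y - y'), A (x - x'))"
    using xy by (simp add: z grad_eq At_diff linear_diff[OF bounded_linear.linear[OF A_bounded_linear]] algebra_simps)
  also have "norm \<dots> \<le> norm (dg x - dg x', 0 :: fvec) + norm ((L / 4) *\<^sub>R (At (y - y'), A (x - x')))"
    by (rule norm_triangle_ineq)
  also have "\<dots> = norm (dg x - dg x') + L / 4 * norm (At (y - y'), A (x - x'))"
    using L by (simp add: norm_Pair1 norm_scaleR[symmetric] del: scaleR_Pair)
  also have "\<dots> \<le> L / 2 * norm (z - z') + L / 4 * (2 * norm (z - z'))"
  proof (intro add_mono mult_left_mono)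
    have "norm (dg x - dg x') \<le> L / 2 * norm (x - x')"
      using xy by (intro dg_lipschitz)
    also have "\<dots> \<le> L / 2 * norm (z - z')"
      using L norm_fst_le[of "x - x'" "y - y'"] by (simp add: z)
    finally show "norm (dg x - dg x') \<le> L / 2 * norm (z - z')" .
    have "(norm (At (y - y')))\<^sup>2 + (norm (A (x - x')))\<^sup>2 \<le> (2 * norm (y - y'))\<^sup>2 + (2 * norm (x - x'))\<^sup>2"
      by (intro add_mono power_mono At_norm A_norm) auto
    then have "(norm (At (y - y'), A (x - x')))\<^sup>2 \<le> (2 * norm (z - z'))\<^sup>2"
      by (simp add: z norm_Pair power_mult_distrib)
    then show "norm (At (y - y'), A (x - x')) \<le> 2 * norm (z - z')"
      by (rule power2_le_imp_le) simp
  qed (use L in auto)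
  also have "\<dots> = L * norm (z - z')" by simp
  finally show ?thesis .
qed

lemma P_in_F_NCC:
  assumes gap: "lam * real T \<le> G0"
  shows "P \<in> F_NCC L G0 D"
proof -
  let ?X = "orthant N" and ?Y = "Rd_ball N (D / 2)"
  have Y: "?Y \<subseteq> Rd N" and X: "?X \<subseteq> Rd N" by (auto simp: Rd_ball_def orthant_def)
  have lip: "norm (grad P z - grad P z') \<le> L * norm (z - z')" if "z \<in> ?X \<times> ?Y" "z' \<in> ?X \<times> ?Y" for z z'
    using that Y by (intro grad_lipschitz) auto
  have "L-lipschitz_on (?X \<times> ?Y) (grad P)"
    using lip L by (intro lipschitz_onI) (simp_all add: dist_norm)
  then have cont: "continuous_on (?X \<times> ?Y) (grad P)" by (rule lipschitz_on_continuous_on)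
  have diff: "\<exists>g. has_gradient (Rd N \<times> Rd N) (obj P) z g" if "z \<in> ?X \<times> ?Y" for z
    by (rule exI, rule grad_exists) (use that Y in auto)
  have closed: "closed ?Y" and convex: "convex ?Y" and bounded: "bounded ?Y"
    unfolding Rd_ball_eq
    by (intro closed_Int closed_Rd closed_cball, intro convex_Int subspace_imp_convex subspace_Rd convex_cball,
        intro bounded_Int disjI2 bounded_cball)
  have concave: "concave_on ?Y (\<lambda>y. obj P (x, y))" for x
  proof -
    \<comment> \<open>The objective is affine in \<open>y\<close>; the minus signs appear because
      concavity unfolds to convexity of the negative.\<close>
    have aff: "- (c + k * ((1 - t) * a + t * b)) = (1 - t) * - (c + k * a) + t * - (c + k * b)"
      for c k a b t :: real by (simp add: algebra_simps)
    show ?thesis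
      unfolding concave_on_def
      by (rule convex_onI[OF _ convex])
        (simp only: P_simps(5) fst_conv snd_conv inner_add_left inner_scaleR_left aff order_refl)
  qed
  have diam: "diameter ?Y \<le> D"
  proof (rule diameter_le)
    fix y y' assume "y \<in> ?Y" "y' \<in> ?Y"
    then show "norm (y - y') \<le> D"
      using norm_triangle_ineq4[of y y'] by (simp add: Rd_ball_def)
  qed (use D in simp)
  \<comment> \<open>The objective vanishes at \<open>x = 0\<close> for every \<open>y\<close> and
    equals \<open>g\<close> at \<open>y = 0\<close>.\<close>
  have "(SUP y\<in>?Y. ereal (obj P (0, y))) - (INF x\<in>?X. ereal (obj P (x, 0))) \<le> ereal 0 - ereal (- lam * real T)"
    using g_lower by (intro ereal_minus_mono SUP_least INF_greatest) (simp_all add: g_0 A_0)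
  also have "\<dots> \<le> ereal G0" using gap by simp
  finally have gap': "(SUP y\<in>?Y. ereal (obj P (0, y))) - (INF x\<in>?X. ereal (obj P (x, 0))) \<le> ereal G0" .
  show ?thesis
    unfolding F_NCC_def mem_Collect_eq P_simps(1-4)
    by (intro conjI ballI X Y zero_in orthant_closed orthant_convex closed convex diff cont lip
        concave bounded diam gap')
qed

section \<open>The primal value function\<close>

definition Phi :: "fvec \<Rightarrow> real" where
  "Phi x = g x + L * D / 8 * norm (A x)"

lemma primal_value_P:
  "primal_value P x = ereal (Phi x)"
proof (rule antisym)
  show "primal_value P x \<le> ereal (Phi x)"
    unfolding primal_value_def
  proof (rule SUP_least)
    fix y assume "y \<in> dom_y P"
    then have "norm y \<le> D / 2" by (simp add: Rd_ball_def)
    have "inner y (A x) \<le> norm y * norm (A x)" by (rule norm_cauchy_schwarz)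
    also have "\<dots> \<le> D / 2 * norm (A x)"
      using \<open>norm y \<le> D / 2\<close> by (intro mult_right_mono) auto
    finally have "L / 4 * inner y (A x) \<le> L / 4 * (D / 2 * norm (A x))"
      using L by (intro mult_left_mono) auto
    then show "ereal (obj P (x, y)) \<le> ereal (Phi x)"
      by (simp add: Phi_def)
  qed
  \<comment> \<open>The maximiser over the ball; \<open>sgn 0 = 0\<close> also covers the kernel of
    \<open>A\<close>.\<close>
  let ?y = "(D / 2) *\<^sub>R sgn (A x)"
  have "sgn (A x) \<in> Rd N"
    unfolding sgn_div_norm by (intro subspace_scale subspace_Rd) (simp add: A_def)
  then have "?y \<in> dom_y P"
    using D by (auto simp: Rd_ball_def norm_sgn intro: subspace_scale[OF subspace_Rd])
  moreover have "inner ?y (A x) = D / 2 * norm (A x)"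
    by (cases "A x = 0") (simp_all add: sgn_div_norm power2_norm_eq_inner[symmetric] power2_eq_square)
  then have "obj P (x, ?y) = Phi x"
    by (simp add: Phi_def)
  ultimately show "ereal (Phi x) \<le> primal_value P x"
    unfolding primal_value_def by (metis SUP_upper)
qed

lemma Phi_lower: "x \<in> orthant N \<Longrightarrow> - lam * real T \<le> Phi x"
  using g_lower[of x] L D by (simp add: Phi_def add_increasing2)

text \<open>Every summand of \<open>g\<close> is a product of increasing factors read at block ends
  only, so interior entries are left free. Index \<open>j\<close> is singled out to quantify the
  decrease.\<close>

lemma g_antimono:
  assumes x: "x \<in> orthant N" and x': "x' \<in> orthant N"
    and le: "\<And>i. m dvd i \<or> m dvd Suc i \<Longrightarrow> coord x i \<le> coord x' i"
    and j: "j < N" "m dvd j"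
  shows "g x' \<le> g x - lam * gate x j * (sat ell (coord x' j) - sat ell (coord x j))"
proof -
  let ?f = "\<lambda>x i. if m dvd i then gate x i * sat ell (coord x i) else 0"
  have nn: "0 \<le> coord x i" "0 \<le> coord x' i" for i using x x' by (auto simp: orthant_def)
  have gate: "gate x i \<le> gate x' i" if "m dvd i" for i
    using le[of "i - 1"] that by (auto simp: gate_def intro!: sat_mono[OF ell nn(1)])
  have "?f x i \<le> ?f x' i" for i
    using gate[of i] le[of i] gate_bounds[OF x, of i] gate_bounds[OF x', of i] sat_bounds[OF ell nn(1)[of i]]
    by (auto intro!: mult_mono sat_mono[OF ell nn(1)])
  then have "(\<Sum>i\<in>{..<N} - {j}. ?f x i) \<le> (\<Sum>i\<in>{..<N} - {j}. ?f x' i)"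
    by (rule sum_mono)
  moreover have "(\<Sum>i<N. ?f z i) = gate z j * sat ell (coord z j) + (\<Sum>i\<in>{..<N} - {j}. ?f z i)" for z
    using j by (subst sum.remove[of _ j]) auto
  moreover have "gate x j * sat ell (coord x' j) \<le> gate x' j * sat ell (coord x' j)"
    using gate[OF j(2)] sat_bounds[OF ell nn(2)[of j]] by (intro mult_right_mono)
  ultimately have "(\<Sum>i<N. ?f x i) + gate x j * (sat ell (coord x' j) - sat ell (coord x j)) \<le> (\<Sum>i<N. ?f x' i)"
    by (simp add: algebra_simps)
  then have "lam * ((\<Sum>i<N. ?f x i) + gate x j * (sat ell (coord x' j) - sat ell (coord x j))) \<le> lam * (\<Sum>i<N. ?f x' i)"
    using lam by (intro mult_left_mono) auto
  then show ?thesis by (simp add: g_def algebra_simps)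
qed

section \<open>Variation inside a block\<close>

lemma sum_blocks: "(\<Sum>i<N. f i) = (\<Sum>k<T. \<Sum>i\<in>{m * k..<m * k + m}. f i)"
  using sum.nat_group[of f m T] by (simp add: N_def mult.commute)

lemma block_dvd:
  assumes "i \<in> {m * k..<m * k + m}"
  shows "i div m = k" "m dvd i \<longleftrightarrow> i = m * k" "m dvd Suc i \<longleftrightarrow> Suc i = m * k + m"
proof -
  obtain r where r: "i = m * k + r" "r < m"
    using assms by (metis atLeastLessThan_iff le_Suc_ex nat_add_left_cancel_less)
  show "i div m = k" "m dvd i \<longleftrightarrow> i = m * k"
    using r nat_dvd_not_less[of r m] dvd_add_right_iff[of m "m * k" r] by auto
  show "m dvd Suc i \<longleftrightarrow> Suc i = m * k + m"
  proof
    assume "m dvd Suc i"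
    then have "m dvd Suc r"
      using r by (metis add_Suc_right dvd_add_right_iff dvd_triv_left)
    then have "m \<le> Suc r" by (rule dvd_imp_le) simp
    then show "Suc i = m * k + m" using r by simp
  next
    assume "Suc i = m * k + m"
    then show "m dvd Suc i" by simp
  qed
qed

text \<open>The ordinary weights add up to \<open>m\<close>, and each heavy end contributes at most
  another \<open>m\<close>.\<close>

lemma block_weight: "(\<Sum>i\<in>{m * k..<m * k + m}. (1 / rho i)\<^sup>2) \<le> 3 * real m"
proof -
  have "(\<Sum>i\<in>{m * k..<m * k + m}. (1 / rho i)\<^sup>2) \<le>
      (\<Sum>i\<in>{m * k..<m * k + m}. 1 + (if i = m * k then real m else 0) + (if i = m * k + m - 1 then real m else 0))"
  proof (rule sum_mono)
    fix i assume i: "i \<in> {m * k..<m * k + m}"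
    show "(1 / rho i)\<^sup>2 \<le> 1 + (if i = m * k then real m else 0) + (if i = m * k + m - 1 then real m else 0)"
      using block_dvd(2,3)[OF i] m by (auto simp: rho_def)
  qed
  also have "\<dots> = 3 * real m"
    using m by (simp add: sum.distrib)
  finally show ?thesis .
qed

lemma link_block: "link i \<longleftrightarrow> Suc i < m * k + m" if "i \<in> {m * k..<m * k + m}" for i
  using block_dvd(3)[OF that] that by (auto simp: link_def)

text \<open>The difference telescopes into entries of \<open>A x\<close> within the block;
  Cauchy-Schwarz over \<open>m\<close> terms costs the factor \<open>m\<close>.\<close>

lemma block_variation:
  assumes "k < T" and i: "i \<in> {m * k..<m * k + m}" and j: "j \<in> {m * k..<m * k + m}"
  shows "(rho i * coord x i - rho j * coord x j)\<^sup>2 \<le>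
    real m * (\<Sum>l\<in>{m * k..<m * k + m}. (coord (A x) l)\<^sup>2)"
proof -
  let ?B = "{m * k..<m * k + m}"
  let ?y = "\<lambda>i. rho i * coord x i"
  have BN: "l < N" if "l \<in> ?B" for l
  proof -
    have "m * k + m \<le> m * T"
      using \<open>k < T\<close> by (metis Suc_leI mult_Suc_right add.commute mult_le_mono2)
    then show ?thesis using that by (simp add: N_def mult.commute)
  qed
  have le: "\<bar>?y a - ?y b\<bar> \<le> (\<Sum>l\<in>?B. \<bar>coord (A x) l\<bar>)" if ab: "a \<le> b" "a \<in> ?B" "b \<in> ?B" for a b
  proof -
    have "?y a - ?y b = (\<Sum>l\<in>{a..<b}. ?y l - ?y (Suc l))"
      using sum_Suc_diff'[of a b "\<lambda>i. - ?y i"] ab by simp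
    also have "\<dots> = (\<Sum>l\<in>{a..<b}. coord (A x) l)"
    proof (rule sum.cong)
      fix l assume l: "l \<in> {a..<b}"
      then have lB: "l \<in> ?B" and "Suc l < m * k + m" using ab by auto
      then show "?y l - ?y (Suc l) = coord (A x) l"
        using link_block[OF lB] BN[OF lB] by (simp add: A_def)
    qed simp
    also have "\<bar>\<dots>\<bar> \<le> (\<Sum>l\<in>{a..<b}. \<bar>coord (A x) l\<bar>)" by (rule sum_abs)
    also have "\<dots> \<le> (\<Sum>l\<in>?B. \<bar>coord (A x) l\<bar>)"
      using ab by (intro sum_mono2) auto
    finally show ?thesis .
  qed
  have "\<bar>?y i - ?y j\<bar> \<le> (\<Sum>l\<in>?B. \<bar>coord (A x) l\<bar> * 1)"
    using le[of i j] le[of j i] i j by (cases "i \<le> j") (auto simp: abs_minus_commute)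
  then have "\<bar>?y i - ?y j\<bar>\<^sup>2 \<le> (\<Sum>l\<in>?B. \<bar>coord (A x) l\<bar> * 1)\<^sup>2"
    by (rule power_mono) simp
  also have "\<dots> \<le> (\<Sum>l\<in>?B. \<bar>coord (A x) l\<bar>\<^sup>2) * (\<Sum>l\<in>?B. 1\<^sup>2)"
    by (rule Cauchy_Schwarz_ineq_sum)
  finally show ?thesis by (simp add: mult.commute)
qed

section \<open>Consensus points\<close>

text \<open>Raising both ends of every block to the larger of the two gives a point \<open>q\<close> in the kernel of
  \<open>A\<close>; it may lie below \<open>p\<close> only at interior indices, on which \<open>g\<close> does not depend.\<close>

definition consensus :: "fvec \<Rightarrow> fvec" where
  "consensus p = mkvec N (\<lambda>i. max (coord p (m * (i div m))) (coord p (m * (i div m) + m - 1)) / sqrt (real m) / rho i)"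

text \<open>\<open>rho i * coord (consensus p) i\<close> is constant on each block, and
  \<open>link\<close> joins only indices of one block.\<close>

lemma A_consensus: "A (consensus p) = 0"
proof (rule fvec_eqI)
  fix i
  show "coord (A (consensus p)) i = coord 0 i"
    using link_div[of i] link_Suc_less[of i] rho_bounds(1)[of i] rho_bounds(1)[of "Suc i"]
    by (auto simp: A_def consensus_def)
qed

lemma consensus_orthant: "p \<in> orthant N \<Longrightarrow> consensus p \<in> orthant N"
  using rho_bounds(1) by (auto simp: orthant_def consensus_def less_imp_le le_max_iff_disj)

lemma consensus_ends:
  assumes "i < N" "m dvd i \<or> m dvd Suc i"
  shows "coord (consensus p) i = max (coord p (m * (i div m))) (coord p (m * (i div m) + m - 1))"
  using assms m by (simp add: consensus_def rho_def)

lemma end_index: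
  assumes "m dvd i \<or> m dvd Suc i"
  shows "i = m * (i div m) \<or> i = m * (i div m) + m - 1"
proof -
  have "i \<in> {m * (i div m)..<m * (i div m) + m}"
    using dividend_less_times_div[OF m_pos, of i] by (simp add: add.commute)
  from block_dvd(2,3)[OF this] assms show ?thesis by auto
qed

lemma consensus_ge:
  assumes "p \<in> orthant N" "m dvd i \<or> m dvd Suc i"
  shows "coord p i \<le> coord (consensus p) i"
proof (cases "i < N")
  case True
  then show ?thesis using consensus_ends[OF True assms(2), of p] end_index[OF assms(2)] by auto
qed (use assms in \<open>auto simp: orthant_def mem_Rd_iff consensus_def\<close>)

text \<open>Each entry deviates by a weighted variation inside its block.
  \<open>block_variation\<close> and \<open>block_weight\<close> together give
  \<open>3 * m^2 \<le> (2 * m)^2\<close>.\<close>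

lemma consensus_dist:
  assumes p: "p \<in> orthant N"
  shows "norm (consensus p - p) \<le> 2 * real m * norm (A p)"
proof -
  let ?B = "\<lambda>k. {m * k..<m * k + m}"
  let ?S = "\<lambda>k. \<Sum>l\<in>?B k. (coord (A p) l)\<^sup>2"
  have "(norm (consensus p - p))\<^sup>2 = (\<Sum>k<T. \<Sum>i\<in>?B k. (coord (consensus p - p) i)\<^sup>2)"
    using subspace_Rd p unfolding sum_blocks[symmetric]
    by (intro norm_sq_Rd subspace_diff) (auto simp: consensus_def orthant_def)
  also have "\<dots> \<le> (\<Sum>k<T. \<Sum>i\<in>?B k. (1 / rho i)\<^sup>2 * (real m * ?S k))"
  proof (intro sum_mono)
    fix k i assume k: "k \<in> {..<T}" and i: "i \<in> ?B k"
    have ik: "i div m = k" using block_dvd(1)[OF i] .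
    have "i < N"
    proof -
      have "m * k + m \<le> m * T"
        using k by (metis Suc_leI mult_Suc_right add.commute mult_le_mono2 lessThan_iff)
      then show ?thesis using i by (simp add: N_def mult.commute)
    qed
    \<comment> \<open>The block end attaining the maximum, which makes the deviation a difference of
      two weighted entries of \<open>p\<close>.\<close>
    define j where "j = (if coord p (m * k) \<ge> coord p (m * k + m - 1) then m * k else m * k + m - 1)"
    have j: "j \<in> ?B k" using m by (auto simp: j_def)
    have "m dvd j \<or> m dvd Suc j" using m by (auto simp: j_def)
    then have "rho j = 1 / sqrt (real m)" by (simp add: rho_def)
    then have "coord (consensus p) i = rho j * coord p j / rho i"
      using \<open>i < N\<close> by (auto simp: consensus_def ik j_def max_def)
    then have "coord (consensus p - p) i = 1 / rho i * (rho j * coord p j - rho i * coord p i)"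
      using rho_bounds(1)[of i] by (simp add: field_simps)
    then have "(coord (consensus p - p) i)\<^sup>2 = (1 / rho i)\<^sup>2 * (rho j * coord p j - rho i * coord p i)\<^sup>2"
      by (simp only: power_mult_distrib)
    also have "\<dots> \<le> (1 / rho i)\<^sup>2 * (real m * ?S k)"
      using k by (intro mult_left_mono block_variation[OF _ j i]) auto
    finally show "(coord (consensus p - p) i)\<^sup>2 \<le> (1 / rho i)\<^sup>2 * (real m * ?S k)" .
  qed
  also have "\<dots> = (\<Sum>k<T. (\<Sum>i\<in>?B k. (1 / rho i)\<^sup>2) * (real m * ?S k))"
    by (simp only: sum_distrib_right)
  also have "\<dots> \<le> (\<Sum>k<T. 3 * real m * (real m * ?S k))"
    by (intro sum_mono mult_right_mono block_weight) (auto intro!: mult_nonneg_nonneg sum_nonneg)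
  also have "\<dots> = 3 * (real m)\<^sup>2 * (\<Sum>k<T. ?S k)"
    by (simp add: sum_distrib_left power2_eq_square mult_ac)
  also have "(\<Sum>k<T. ?S k) = (norm (A p))\<^sup>2"
    unfolding sum_blocks[symmetric] by (rule norm_sq_Rd[symmetric]) (simp add: A_def)
  also have "3 * (real m)\<^sup>2 * (norm (A p))\<^sup>2 \<le> (2 * real m * norm (A p))\<^sup>2"
    by (simp add: power_mult_distrib mult_right_mono)
  finally show ?thesis by (rule power2_le_imp_le) simp
qed

section \<open>Descent directions\<close>

text \<open>A kernel direction of \<open>A\<close> with entry 1 at both ends of the block and
  \<open>1 / sqrt (real m)\<close> inside, hence of norm bounded independently of
  \<open>m\<close>.\<close>

definition lift :: "nat \<Rightarrow> fvec" where
  "lift k = mkvec N (\<lambda>i. if i div m = k then 1 / (sqrt (real m) * rho i) else 0)"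

lemma A_lift: "A (lift k) = 0"
proof (rule fvec_eqI)
  fix i
  show "coord (A (lift k)) i = coord 0 i"
    using link_div[of i] link_Suc_less[of i] rho_bounds(1)[of i] rho_bounds(1)[of "Suc i"]
    by (auto simp: A_def lift_def)
qed

lemma lift_nonneg: "0 \<le> coord (lift k) i"
  using rho_bounds(1)[of i] by (simp add: lift_def)

lemma lift_norm:
  assumes "k < T"
  shows "norm (lift k) \<le> 2"
proof -
  have "(norm (lift k))\<^sup>2 = (\<Sum>k'<T. \<Sum>i\<in>{m * k'..<m * k' + m}. (coord (lift k) i)\<^sup>2)"
    unfolding sum_blocks[symmetric] by (rule norm_sq_Rd) (simp add: lift_def)
  also have "\<dots> \<le> (\<Sum>k'<T. if k' = k then 3 else 0)"
  proof (rule sum_mono)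
    fix k'
    have "(\<Sum>i\<in>{m * k'..<m * k' + m}. (coord (lift k) i)\<^sup>2) \<le>
        (\<Sum>i\<in>{m * k'..<m * k' + m}. if k' = k then 1 / real m * (1 / rho i)\<^sup>2 else 0)"
      by (rule sum_mono) (auto simp: lift_def block_dvd(1) power_mult_distrib power_divide)
    also have "\<dots> \<le> (if k' = k then 1 / real m * (3 * real m) else 0)"
    proof (cases "k' = k")
      case True
      show ?thesis
        unfolding True by (simp only: refl if_True sum_distrib_left[symmetric])
          (intro mult_left_mono block_weight; simp)
    qed simp
    also have "\<dots> = (if k' = k then 3 else 0)" using m by simp
    finally show "(\<Sum>i\<in>{m * k'..<m * k' + m}. (coord (lift k) i)\<^sup>2) \<le> (if k' = k then 3 else 0)" .
  qed
  also have "\<dots> \<le> 2\<^sup>2" using assms by simp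
  finally show ?thesis by (rule power2_le_imp_le) simp
qed

text \<open>The step leaves \<open>A p\<close> unchanged and raises the block start, where the
  half-open gate and unsaturated \<open>sat\<close> make \<open>g\<close> fall.\<close>

lemma descent_along_lift:
  assumes p: "p \<in> orthant N" and k: "k < T"
    and gate: "1 / 2 \<le> gate p (m * k)" and le: "coord p (m * k) \<le> 2 * ell"
    and \<tau>: "0 < \<tau>" "\<tau> \<le> ell"
  shows "\<exists>h. norm h \<le> \<tau> \<and> p + h \<in> orthant N \<and> Phi (p + h) \<le> Phi p - 2 * \<epsilon> * \<tau>"
proof (intro exI conjI)
  let ?h = "(\<tau> / 2) *\<^sub>R lift k" and ?j = "m * k"
  have mono: "coord p i \<le> coord (p + ?h) i" for i
    using lift_nonneg[of k i] \<tau> by simp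
  show "norm ?h \<le> \<tau>" using lift_norm[OF k] \<tau> by simp
  have lift: "lift k \<in> Rd N" by (simp add: lift_def)
  show ph: "p + ?h \<in> orthant N"
    using p mono subspace_add[OF subspace_Rd _ subspace_scale[OF subspace_Rd lift, of "\<tau> / 2"], of p]
    by (auto simp: orthant_def intro: order_trans)
  have j: "?j < N" "m dvd ?j" using k m_pos by (auto simp: N_def)
  have a: "0 \<le> coord p ?j" using p by (simp add: orthant_def)
  have "coord (lift k) ?j = 1" using j m by (simp add: lift_def rho_def)
  then have hj: "coord (p + ?h) ?j = coord p ?j + \<tau> / 2" by simp
  \<comment> \<open>The denominators are at most \<open>ell + 2 * ell\<close> and
    \<open>ell + 2 * ell + ell / 2\<close>. Then \<open>96 * 1/2 * 1/24 = 2\<close> is the required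
    rate.\<close>
  have "\<tau> / (24 * ell) = ell * (\<tau> / 2) / ((3 * ell) * (4 * ell))"
    using ell by (simp add: field_simps)
  also have "\<dots> \<le> ell * (\<tau> / 2) / ((ell + coord p ?j) * (ell + (coord p ?j + \<tau> / 2)))"
    using ell a \<tau> le by (intro divide_left_mono mult_mono mult_pos_pos) auto
  also have "\<dots> = sat ell (coord (p + ?h) ?j) - sat ell (coord p ?j)"
    using sat_diff[OF ell a, of "coord p ?j + \<tau> / 2"] a \<tau> hj by simp
  finally have "1 / 2 * (\<tau> / (24 * ell)) \<le>
      gate p ?j * (sat ell (coord (p + ?h) ?j) - sat ell (coord p ?j))"
    using gate ell \<tau> by (intro mult_mono) auto
  then have "lam * (1 / 2 * (\<tau> / (24 * ell))) \<le>
      lam * (gate p ?j * (sat ell (coord (p + ?h) ?j) - sat ell (coord p ?j)))"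
    using lam by (intro mult_left_mono) auto
  moreover have "lam * (1 / 2 * (\<tau> / (24 * ell))) = 2 * \<epsilon> * \<tau>"
    using ell by (simp add: lam_div_ell(2))
  moreover have "g (p + ?h) \<le> g p - lam * gate p ?j * (sat ell (coord (p + ?h) ?j) - sat ell (coord p ?j))"
    using mono by (intro g_antimono p ph j) auto
  ultimately have "g (p + ?h) \<le> g p - 2 * \<epsilon> * \<tau>" by simp
  moreover have "A (p + ?h) = A p"
    using bounded_linear.linear[OF A_bounded_linear] by (simp add: linear_add linear_scale A_lift)
  ultimately show "Phi (p + ?h) \<le> Phi p - 2 * \<epsilon> * \<tau>" by (simp add: Phi_def)
qed

text \<open>On the segment to the consensus point \<open>g\<close> does not increase, while
  \<open>A\<close> shrinks linearly to 0; \<open>consensus_dist\<close> and \<open>m_le\<close>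
  convert this into the rate.\<close>

lemma descent_towards_consensus:
  assumes p: "p \<in> orthant N" and k: "k < T"
    and ends: "coord p (m * k + m - 1) + ell \<le> coord p (m * k)"
    and \<tau>: "0 < \<tau>" "\<tau> \<le> ell"
  shows "\<exists>h. norm h \<le> \<tau> \<and> p + h \<in> orthant N \<and> Phi (p + h) \<le> Phi p - 2 * \<epsilon> * \<tau>"
proof (intro exI conjI)
  define K where "K = norm (consensus p - p)"
  let ?e = "m * k + m - 1"
  have e: "?e \<in> {m * k..<m * k + m}" using m by auto
  have "m * k + m \<le> m * T"
    using k by (metis Suc_leI mult_Suc_right add.commute mult_le_mono2)
  then have eN: "?e < N" using m_pos by (simp add: N_def mult.commute)
  have "m dvd Suc ?e" using m by simp
  then have "coord (consensus p) ?e = max (coord p (m * k)) (coord p ?e)"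
    using consensus_ends[OF eN, of p] block_dvd(1)[OF e] by simp
  then have "ell \<le> \<bar>coord (consensus p - p) ?e\<bar>" using ends by simp
  also have "\<dots> \<le> K" unfolding K_def by (rule abs_coord_le_norm)
  finally have K: "ell \<le> K" .
  \<comment> \<open>A step of length \<open>\<tau>\<close>; the gap between the ends gives
    \<open>\<tau> \<le> ell \<le> K\<close>, so it does not overshoot.\<close>
  define s where "s = \<tau> / K"
  have s: "0 < s" "s \<le> 1" "s * K = \<tau>" using K ell \<tau> by (auto simp: s_def)
  let ?h = "s *\<^sub>R (consensus p - p)"
  have ph_eq: "p + ?h = (1 - s) *\<^sub>R p + s *\<^sub>R consensus p" by (simp add: algebra_simps)
  show "norm ?h \<le> \<tau>" using s by (simp add: K_def)
  show ph: "p + ?h \<in> orthant N"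
    unfolding ph_eq using s by (intro convexD orthant_convex consensus_orthant p) auto
  have "g (p + ?h) \<le> g p - lam * gate p 0 * (sat ell (coord (p + ?h) 0) - sat ell (coord p 0))"
    using s consensus_ge[OF p] N_pos by (intro g_antimono p ph) auto
  also have "\<dots> \<le> g p"
  proof -
    have "sat ell (coord p 0) \<le> sat ell (coord (p + ?h) 0)"
      using s consensus_ge[OF p, of 0] p by (intro sat_mono[OF ell]) (auto simp: orthant_def)
    then show ?thesis using lam by (simp add: gate_def)
  qed
  finally have g: "g (p + ?h) \<le> g p" .
  have "A (p + ?h) = (1 - s) *\<^sub>R A p"
    unfolding ph_eq using bounded_linear.linear[OF A_bounded_linear]
    by (simp add: linear_add linear_scale A_consensus)
  then have nA: "norm (A (p + ?h)) = norm (A p) - s * norm (A p)"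
    using s by (simp only: norm_scaleR) (simp add: left_diff_distrib)
  have "2 * \<epsilon> * \<tau> = 2 * \<epsilon> * s * K" using s by (simp add: mult_ac)
  also have "\<dots> \<le> 2 * \<epsilon> * s * (2 * real m * norm (A p))"
    unfolding K_def using eps s by (intro mult_left_mono consensus_dist p) auto
  also have "\<dots> = (32 * \<epsilon> * real m) * (s * norm (A p) / 8)" by simp
  also have "\<dots> \<le> (L * D) * (s * norm (A p) / 8)"
    using m_le s by (intro mult_right_mono) auto
  finally have "2 * \<epsilon> * \<tau> \<le> L * D / 8 * (s * norm (A p))" by simp
  then show "Phi (p + ?h) \<le> Phi p - 2 * \<epsilon> * \<tau>"
    using g by (simp add: Phi_def nA right_diff_distrib)
qed

text \<open>The first block whose terminal entry is still below \<open>ell\<close> either has a small initial entry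
  behind an open gate, or its two ends disagree.\<close>

lemma descent_step:
  assumes p: "p \<in> orthant N" and last: "coord p (N - 1) < ell" and \<tau>: "0 < \<tau>" "\<tau> \<le> ell"
  shows "\<exists>h. norm h \<le> \<tau> \<and> p + h \<in> orthant N \<and> Phi (p + h) \<le> Phi p - 2 * \<epsilon> * \<tau>"
proof -
  let ?Q = "\<lambda>k. coord p (m * k + m - 1) < ell"
  have "m * (T - 1) + m = N"
    using T by (simp add: N_def diff_mult_distrib2 mult.commute)
  then have Q: "?Q (T - 1)" using last by simp
  define k where "k = (LEAST k. ?Q k)"
  have k: "?Q k" "k \<le> T - 1" unfolding k_def using Q by (auto intro: LeastI Least_le)
  have kT: "k < T" using k T by simp
  have gate: "1 / 2 \<le> gate p (m * k)"
  proof (cases k)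
    case (Suc k')
    then have "\<not> ?Q k'" unfolding k_def using not_less_Least[of k' ?Q] by (simp add: k_def)
    then have "ell \<le> coord p (m * k - 1)" using Suc by (simp add: add.commute)
    \<comment> \<open>\<open>sat ell ell = 1 / 2\<close>, so a finished previous block opens the
      gate halfway.\<close>
    then have "sat ell ell \<le> sat ell (coord p (m * k - 1))"
      using ell by (intro sat_mono[OF ell]) auto
    then show ?thesis using Suc m ell by (simp add: gate_def sat_def)
  qed (simp add: gate_def)
  show ?thesis
  proof (cases "coord p (m * k) \<le> 2 * ell")
    case True
    then show ?thesis by (rule descent_along_lift[OF p kT gate _ \<tau>])
  next
    case False
    \<comment> \<open>A start above \<open>2 * ell\<close> and an end below \<open>ell\<close>
      differ by at least \<open>ell\<close>.\<close>
    then show ?thesis using k by (intro descent_towards_consensus[OF p kT _ \<tau>]) simp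
  qed
qed

section \<open>The Moreau envelope of the instance\<close>

lemma moreau_P:
  defines "M \<equiv> (\<lambda>x'. real_of_ereal (moreau N (1 / (2 * L)) (ext_primal P) x'))"
  shows moreau_upper: "p \<in> orthant N \<Longrightarrow> M x' \<le> Phi p + L * (norm (p - x'))\<^sup>2"
    and moreau_approx: "0 < \<delta> \<Longrightarrow> \<exists>p\<in>orthant N. Phi p + L * (norm (p - x'))\<^sup>2 \<le> M x' + \<delta>"
proof -
  let ?M = "moreau N (1 / (2 * L)) (ext_primal P) x'"
  let ?f = "\<lambda>p. ext_primal P p + ereal ((norm (p - x'))\<^sup>2 / (2 * (1 / (2 * L))))"
  have f: "?f p = (if p \<in> orthant N then ereal (Phi p + L * (norm (p - x'))\<^sup>2) else \<infinity>)" for p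
    using L by (simp add: ext_primal_def primal_value_P)
  have up: "?M \<le> ereal (Phi p + L * (norm (p - x'))\<^sup>2)" if "p \<in> orthant N" for p
    using INF_lower[of p "Rd N" ?f] that unfolding moreau_def f by (simp add: orthant_def)
  \<comment> \<open>This lower bound and the value at \<open>p = 0\<close> make the envelope finite,
    so passing to reals is faithful.\<close>
  have "ereal (- lam * real T) \<le> ?f p" for p
    unfolding f using Phi_lower[of p] L by (auto intro: add_increasing2)
  then have "ereal (- lam * real T) \<le> ?M"
    unfolding moreau_def by (rule INF_greatest)
  then have M: "?M = ereal (M x')"
    using up[OF zero_in(1)] unfolding M_def by (cases ?M) auto
  show "p \<in> orthant N \<Longrightarrow> M x' \<le> Phi p + L * (norm (p - x'))\<^sup>2"
    using up[of p] M by simp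
  show "\<exists>p\<in>orthant N. Phi p + L * (norm (p - x'))\<^sup>2 \<le> M x' + \<delta>" if "0 < \<delta>"
  proof -
    have "(INF p\<in>Rd N. ?f p) < ereal (M x' + \<delta>)"
      using M that unfolding moreau_def by simp
    then obtain p where "?f p < ereal (M x' + \<delta>)" by (auto simp: INF_less_iff)
    then show ?thesis unfolding f by (intro bexI[of _ p]) (auto split: if_splits)
  qed
qed

text \<open>Points within \<open>\<epsilon> / L\<close> of \<open>x\<close> have last coordinate
  below \<open>ell = 768 * \<epsilon> / L\<close>, so \<open>descent_step\<close> applies to all of
  them.\<close>

lemma not_stationary:
  assumes x: "coord x (N - 1) = 0"
  shows "\<not> stationary L P \<epsilon> x"
proof
  let ?M = "\<lambda>x'. real_of_ereal (moreau N (1 / (2 * L)) (ext_primal P) x')"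
  assume "stationary L P \<epsilon> x"
  then obtain v where v: "x \<in> orthant N" "has_gradient (Rd N) ?M x v" "norm v \<le> \<epsilon>"
    by (auto simp: stationary_def)
  have "\<epsilon> < norm v"
  proof (rule envelope_gradient_large[OF subspace_Rd _ _ L eps ell v(2), where X = "orthant N" and \<Phi> = Phi])
    fix p \<tau> assume p: "p \<in> orthant N" "norm (p - x) \<le> \<epsilon> / L" and \<tau>: "0 < \<tau>" "\<tau> \<le> ell"
    have "coord p (N - 1) \<le> norm (p - x)"
      using abs_coord_le_norm[of "p - x" "N - 1"] x by simp
    also have "\<dots> < ell" using p(2) L eps by (simp add: ell_def field_simps)
    finally show "\<exists>h. norm h \<le> \<tau> \<and> p + h \<in> orthant N \<and> Phi (p + h) \<le> Phi p - 2 * \<epsilon> * \<tau>"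
      using p(1) \<tau> by (intro descent_step)
  qed (use v(1) moreau_upper moreau_approx in \<open>auto simp: orthant_def\<close>)
  then show False using v(3) by simp
qed

section \<open>Growth of the discovered support\<close>

text \<open>Both gradients couple only neighbouring indices, and \<open>sat ell 0 = 0\<close> keeps
  a gate closed until its preceding entry is nonzero. Only index 0 starts unaided.\<close>

lemma supp_grad:
  assumes x: "x \<in> orthant N" and y: "y \<in> Rd N"
    and supp: "supp x \<subseteq> {..<q}" "supp y \<subseteq> {..<q}"
  shows "supp (grad_x P (x, y)) \<subseteq> {..<Suc q}" "supp (grad_y P (x, y)) \<subseteq> {..<Suc q}"
proof -
  have 0: "coord x i = 0" "coord y i = 0" if "q \<le> i" for i
    using supp that by (force simp: supp_def)+
  have "coord (grad_x P (x, y)) i = 0" if "Suc q \<le> i" for i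
    using that 0(1)[of "i - 1"] 0(1)[of "Suc i"] 0(2)[of i] 0(2)[of "i - 1"]
    by (simp add: grad_x_def grad_eq[OF x y] dg_def At_def coef_def gate_def)
  then show "supp (grad_x P (x, y)) \<subseteq> {..<Suc q}"
    unfolding supp_def by (auto intro: ccontr simp: not_less)
  have "coord (grad_y P (x, y)) i = 0" if "Suc q \<le> i" for i
    using that 0(1)[of i] 0(1)[of "Suc i"]
    by (simp add: grad_y_def grad_eq[OF x y] A_def)
  then show "supp (grad_y P (x, y)) \<subseteq> {..<Suc q}"
    unfolding supp_def by (auto intro: ccontr simp: not_less)
qed

lemma seen_subset:
  assumes zr: "zero_respecting P alg"
  shows "q \<le> N \<Longrightarrow> seen_x P alg q \<subseteq> {..<q} \<and> seen_y P alg q \<subseteq> {..<q}"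
proof (induction q)
  case (Suc q)
  then have IH: "seen_x P alg q \<subseteq> {..<q}" "seen_y P alg q \<subseteq> {..<q}" and "q \<le> N" by auto
  obtain x y where it: "iterate P alg q = (x, y)" by fastforce
  have "x \<in> orthant N \<and> y \<in> Rd N \<and> supp x \<subseteq> {..<q} \<and> supp y \<subseteq> {..<q}"
  proof (cases q)
    case 0
    then show ?thesis
      using zr it zero_in by (auto simp: zero_respecting_def Rd_ball_def)
  next
    case (Suc t)
    then obtain u v where uv: "supp u \<subseteq> seen_x P alg q" "supp v \<subseteq> seen_y P alg q"
      "x = proj (orthant N) u" "y = proj (Rd_ball N (D / 2)) v"
      using zr it unfolding zero_respecting_def by (metis P_simps(3,4) prod.inject)
    \<comment> \<open>Here \<open>q \<le> N\<close> enters: the projection lemmas need arguments in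
      \<open>Rd N\<close>.\<close>
    have "u \<in> Rd N" "v \<in> Rd N"
      using uv IH \<open>q \<le> N\<close> by (auto simp: Rd_def)
    then show ?thesis
      using proj_orthant[of u N] proj_Rd_ball[of v N "D / 2"] uv IH D by (auto simp: Rd_ball_def)
  qed
  then have "supp x \<subseteq> {..<Suc q}" "supp y \<subseteq> {..<Suc q}"
    "supp (grad_x P (x, y)) \<subseteq> {..<Suc q}" "supp (grad_y P (x, y)) \<subseteq> {..<Suc q}"
    using supp_grad[of x y q] by auto
  moreover have "seen_x P alg (Suc q) = seen_x P alg q \<union> (supp x \<union> supp (grad_x P (x, y)))"
    "seen_y P alg (Suc q) = seen_y P alg q \<union> (supp y \<union> supp (grad_y P (x, y)))"
    by (auto simp: seen_x_def seen_y_def lessThan_Suc it)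
  ultimately show ?case using IH by auto
qed (simp add: seen_x_def seen_y_def)

lemma complexity_lower_bound:
  assumes zr: "zero_respecting P alg" and stat: "stationary L P \<epsilon> (output_after P alg q)"
  shows "N \<le> q"
proof (rule ccontr)
  assume "\<not> N \<le> q"
  then have q: "q \<le> N - 1" "q \<le> N" by auto
  obtain u where u: "supp u \<subseteq> seen_x P alg q" "output_after P alg q = proj (orthant N) u"
    using zr unfolding zero_respecting_def P_simps by blast
  then have uq: "supp u \<subseteq> {..<q}" using seen_subset[OF zr q(2)] by auto
  then have "u \<in> Rd N" using q by (auto simp: Rd_def)
  then have "supp (output_after P alg q) \<subseteq> {..<q}"
    using proj_orthant[of u N] u uq by auto
  then have "coord (output_after P alg q) (N - 1) = 0"
    using q by (auto simp: supp_def)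
  from not_stationary[OF this] stat show False by simp
qed

end

section \<open>Choice of parameters\<close>

lemma floor_nat_bounds:
  fixes r :: real
  assumes "1 \<le> r"
  shows "1 \<le> nat \<lfloor>r\<rfloor>" "real (nat \<lfloor>r\<rfloor>) \<le> r" "r / 2 \<le> real (nat \<lfloor>r\<rfloor>)"
proof -
  have "1 \<le> \<lfloor>r\<rfloor>" using assms by simp
  then have "1 \<le> real_of_int \<lfloor>r\<rfloor>" "real (nat \<lfloor>r\<rfloor>) = real_of_int \<lfloor>r\<rfloor>" by simp_all
  then show "1 \<le> nat \<lfloor>r\<rfloor>" "real (nat \<lfloor>r\<rfloor>) \<le> r" "r / 2 \<le> real (nat \<lfloor>r\<rfloor>)"
    using real_of_int_floor_add_one_gt[of r] by linarith+
qed

theorem corollary4p2: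
  shows "\<exists>c c' :: real. c > 0 \<and> c' > 0 \<and>
    (\<forall>L G0 D \<epsilon> :: real. L > 0 \<longrightarrow> G0 > 0 \<longrightarrow> D > 0 \<longrightarrow>
      0 < \<epsilon> \<longrightarrow> \<epsilon> \<le> c * min (sqrt (L * G0)) (L * D) \<longrightarrow>
      (\<exists>P \<in> F_NCC L G0 D. \<forall>A. zero_respecting P A \<longrightarrow>
        (\<forall>q. stationary L P \<epsilon> (output_after P A q) \<longrightarrow>
          c' * L\<^sup>2 * D * G0 / \<epsilon> ^ 3 \<le> real q)))"
proof (rule exI[of _ "1 / 300"], rule exI[of _ "1 / 9437184"], intro conjI allI impI)
  \<comment> \<open>\<open>1 / 300\<close> suffices because \<open>300 \<ge> 64\<close> and
    \<open>300^2 \<ge> 73728\<close>, which give \<open>m \<ge> 2\<close> and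
    \<open>T \<ge> 1\<close>. The second constant is \<open>1 / (73728 * 2 * 32 * 2)\<close>, each 2
    paying for a floor.\<close>
  fix L G0 D \<epsilon> :: real
  assume L: "L > 0" and G0: "G0 > 0" and D: "D > 0" and eps: "0 < \<epsilon>"
    and small: "\<epsilon> \<le> 1 / 300 * min (sqrt (L * G0)) (L * D)"
  have "\<epsilon> \<le> 1 / 300 * sqrt (L * G0)" "\<epsilon> \<le> 1 / 300 * (L * D)"
    using small by auto
  then have small_D: "64 * \<epsilon> \<le> L * D" and "300 * \<epsilon> \<le> sqrt (L * G0)"
    using eps by simp_all
  then have "(300 * \<epsilon>)\<^sup>2 \<le> (sqrt (L * G0))\<^sup>2"
    using eps by (intro power_mono) simp_all
  then have small_G0: "73728 * \<epsilon>\<^sup>2 \<le> L * G0"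
  proof -
    assume "(300 * \<epsilon>)\<^sup>2 \<le> (sqrt (L * G0))\<^sup>2"
    then have "90000 * \<epsilon>\<^sup>2 \<le> L * G0"
      using L G0 by (simp add: power_mult_distrib)
    then show ?thesis using zero_le_power2[of \<epsilon>] by linarith
  qed
  \<comment> \<open>\<open>m\<close> is the largest integer allowed by \<open>m_le\<close>, and
    \<open>T\<close> the largest with \<open>lam * real T \<le> G0\<close>, since
    \<open>lam = 73728 * \<epsilon>^2 / L\<close>.\<close>
  define m where "m = nat \<lfloor>L * D / (32 * \<epsilon>)\<rfloor>"
  define T where "T = nat \<lfloor>L * G0 / (73728 * \<epsilon>\<^sup>2)\<rfloor>"
  have "1 \<le> L * D / (32 * \<epsilon>)" "2 \<le> L * D / (32 * \<epsilon>)" "1 \<le> L * G0 / (73728 * \<epsilon>\<^sup>2)"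
    using small_D small_G0 eps by (simp_all add: field_simps)
  note m_bounds = floor_nat_bounds[OF this(1), folded m_def] and T_bounds = floor_nat_bounds[OF this(3), folded T_def]
    and m2 = this(2)
  interpret chain_instance L \<epsilon> D m T
  proof
    show "2 \<le> m" using m2 unfolding m_def by (simp add: le_nat_iff le_floor_iff)
    show "32 * \<epsilon> * real m \<le> L * D" using m_bounds(2) eps by (simp add: field_simps)
  qed (use L D eps T_bounds(1) in auto)
  have lam_eq: "lam = 73728 * \<epsilon>\<^sup>2 / L"
    using L by (simp add: lam_def ell_def power2_eq_square)
  have "lam * real T \<le> G0"
    using T_bounds(2) L eps by (simp add: lam_eq field_simps)
  then have "P \<in> F_NCC L G0 D" by (rule P_in_F_NCC)
  moreover have "1 / 9437184 * L\<^sup>2 * D * G0 / \<epsilon> ^ 3 \<le> real q"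
    if "zero_respecting P A" "stationary L P \<epsilon> (output_after P A q)" for A q
  proof -
    have "1 / 9437184 * L\<^sup>2 * D * G0 / \<epsilon> ^ 3 =
        (L * G0 / (73728 * \<epsilon>\<^sup>2) / 2) * (L * D / (32 * \<epsilon>) / 2)"
      by (simp add: power2_eq_square power3_eq_cube mult_ac)
    also have "\<dots> \<le> real T * real m"
      using m_bounds(3) T_bounds(3) L G0 D eps by (intro mult_mono) auto
    also have "\<dots> = real N" by (simp add: N_def)
    also have "\<dots> \<le> real q" using complexity_lower_bound[OF that] by simp
    finally show ?thesis .
  qed
  ultimately show "\<exists>P \<in> F_NCC L G0 D. \<forall>A. zero_respecting P A \<longrightarrow>
        (\<forall>q. stationary L P \<epsilon> (output_after P A q) \<longrightarrow>
          1 / 9437184 * L\<^sup>2 * D * G0 / \<epsilon> ^ 3 \<le> real q)"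
    by blast
qed simp_all

end
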